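(* Suppose that $K_1,K_2$ are Mercer kernels with $K_1,K_2\in C^4(\Omega\times\Omega)$. Then for every $\lambda_1,\lambda_2>0$ the minimizer $(\widehat V_{\lambda,NL},\widehat W_{\lambda,NL})$ over $\mathcal H_{K_1}\times\mathcal H_{K_2}$ of the regularized empirical loss functional $$\widehat R_{\lambda,NL}(\phi,\psi)=\frac{T|\Omega|}{NL}\sum_{l=1}^{L}\sum_{n=1}^{N}\big|A^\delta(\phi,\psi)(t_l,x_n)-f^\delta(t_l,x_n)\big|^2\rho_{t_l}(x_n)+\lambda_1\|\phi\|_{\mathcal H_{K_1}}^2+\lambda_2\|\psi\|_{\mathcal H_{K_2}}^2$$ can be written as $$\widehat V_{\lambda,NL}=\big\langle\widehat{\mathbf C}_1,\Delta_{\rho_L}^{(1,0)\delta}K_1(X_N,\cdot)\big\rangle_{C_\rho},\qquad \widehat W_{\lambda,NL}=\big\langle\widehat{\mathbf C}_2,\Delta_{\rho_L}^{(1,0)\delta}(K_2*\rho_L)(X_N,\cdot)\big\rangle_{C_\rho},$$ where the coefficients $\widehat{\mathbf C}_1,\widehat{\mathbf C}_2\in\mathbb R^{NL}$ are given by $$\widehat{\mathbf C}_1=\lambda_2\Big(G_{NL}+\lambda_1\lambda_2\tfrac{NL}{T|\Omega|}C_\rho\Big)^{-1}C_\rho f_{NL}^\delta,\qquad \widehat{\mathbf C}_2=\lambda_1\Big(G_{NL}+\lambda_1\lambda_2\tfrac{NL}{T|\Omega|}C_\rho\Big)^{-1}C_\rho f_{NL}^\delta .$$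
   Context: Setting ($d=1$). $\Omega=[a,b]$, $|\Omega|=b-a$, $T>0$, $\Delta x=|\Omega|/N$, $\Delta t=T/L$, $x_n=a+n\Delta x$, $t_l=l\Delta t$ ($1\le n\le N$, $1\le l\le L$). $\rho_t=\rho(t,\cdot)$, $t\in[0,T]$, are probability densities, $\rho_l^n=\rho(t_l,x_n)>0$. A Mercer kernel is a continuous, symmetric, positive semidefinite kernel; $\mathcal H_{K_i}$ is the RKHS of $K_i$; the kernels are defined on $\mathbb R\times\mathbb R$ and the stated regularity is understood at all arguments at which they are evaluated. Forward differences: $(\delta_t^+\rho)_l^n=(\rho_{l+1}^n-\rho_l^n)/\Delta t$ for $l<L$ and $-\rho_l^n/\Delta t$ for $l=L$; $(\delta_x^+\rho)_l^n=(\rho_l^{n+1}-\rho_l^n)/\Delta x$ for $n<N$ and $-\rho_l^n/\Delta x$ for $n=N$; $(\delta_{tt}^+\rho)_l^n=((\delta_t^+\rho)_{l+1}^n-(\delta_t^+\rho)_l^n)/\Delta t$ for $l<L$ and $-(\delta_t^+\rho)_l^n/\Delta t$ for $l=L$. Operators. For a function $g$ of $x$ put $D_{l,n}g=(\delta_x^+\rho)_l^n\,g'(x_n)+\rho_l^n\,g''(x_n)$. Convolutions: $(\psi*\rho_t)(x)=\int\psi(x-z)\rho_t(z)dz$, $(K*\rho_t)(x,y)=\int K(x-z,y)\rho_t(z)dz$, $(K**(\rho_t,\rho_s))(x,y)=\iint K(x-z_1,y-z_2)\rho_t(z_1)\rho_s(z_2)dz_1dz_2$. Then $A^\delta(\phi,\psi)(t_l,x_n)=D_{l,n}(\phi+\psi*\rho_{t_l})$.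 All vectors in $\mathbb R^{NL}$ are indexed by $(l,n)$ in the order $(t_1,x_1),(t_1,x_2),\dots,(t_L,x_N)$. $\Delta_{\rho_L}^{(1,0)\delta}K_1(X_N,\cdot)$ is the vector of functions with $(l,n)$ entry $D_{l,n}$ applied to the first variable of $K_1$, and $\Delta_{\rho_L}^{(1,0)\delta}(K_2*\rho_L)(X_N,\cdot)$ the vector with $(l,n)$ entry $D_{l,n}$ applied to the first variable of $K_2*\rho_{t_l}$. $\Delta_{\rho_L}^{(1,1)\delta}K_1(X_N,X_N)$ is the $NL\times NL$ matrix with $((l,n),(k,m))$ entry obtained by applying $D_{l,n}$ to the first and $D_{k,m}$ to the second variable of $K_1$; $\Delta_{\rho_L}^{(1,1)\delta}(K_2**\rho_L)(X_N,X_N)$ is defined likewise with $K_2**(\rho_{t_l},\rho_{t_k})$ in the $((l,n),(k,m))$ entry. $C_\rho=\operatorname{diag}\{\rho_{t_1}(x_1),\rho_{t_1}(x_2),\dots,\rho_{t_L}(x_N)\}$, $\langle u,v\rangle_{C_\rho}=u^\top C_\rho v$ (also used when $v$ is a vector of functions), and the Gram matrix is $$G_{NL}=C_\rho\Big(\lambda_2\Delta_{\rho_L}^{(1,1)\delta}K_1(X_N,X_N)+\lambda_1\Delta_{\rho_L}^{(1,1)\delta}(K_2**\rho_L)(X_N,X_N)\Big)C_\rho .$$ Data vector. $f_{NL}^\delta=(f^\delta(t_l,x_n))_{l,n}$. With $\Delta_\rho g=\nabla\cdot(\rho\nabla g)$ and a known internal energy function $U$: for data from the Wasserstein gradient flow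 $\partial_t\rho_t-\Delta_{\rho_t}U'(\rho_t)=\Delta_{\rho_t}(V+W*\rho_t)$, $f^\delta(t_l,x_n)=(\delta_t^+\rho)_l^n-(\delta_x^+\rho)_l^n\partial_xU'(\rho_l^n)-\rho_l^n\partial_{xx}U'(\rho_l^n)$; for data from the Wasserstein Hamiltonian flow $\partial_{tt}\rho_t+\Gamma_W(\partial_t\rho_t,\partial_t\rho_t)-\Delta_{\rho_t}U'(\rho_t)=\Delta_{\rho_t}(V+W*\rho_t)$, $f^\delta(t_l,x_n)=(\delta_{tt}^+\rho)_l^n+\Gamma_W((\delta_t^+\rho)_l^n,(\delta_t^+\rho)_l^n)-(\delta_x^+\rho)_l^n\partial_xU'(\rho_l^n)-\rho_l^n\partial_{xx}U'(\rho_l^n)$, where $\Gamma_W(\sigma,\sigma)=-(\Delta_\sigma\Delta_{\rho_t}^\dagger\sigma+\tfrac12\Delta_{\rho_t}|\nabla\Delta_{\rho_t}^\dagger\sigma|^2)$ and $\Delta_\rho^\dagger$ is the pseudo-inverse of $\Delta_\rho$. *)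

theory Defs
  imports "HOL-Analysis.Analysis" "Jordan_Normal_Form.Gauss_Jordan_Elimination"
begin

section \<open>Kernels and reproducing kernel Hilbert spaces\<close>

definition mercer_kernel :: "(real \<Rightarrow> real \<Rightarrow> real) \<Rightarrow> bool" where
  "mercer_kernel K \<longleftrightarrow>
     continuous_on UNIV (\<lambda>(x, y). K x y) \<and>
     (\<forall>x y. K x y = K y x) \<and>
     (\<forall>(n::nat) (x :: nat \<Rightarrow> real) (c :: nat \<Rightarrow> real).
        0 \<le> (\<Sum>i<n. \<Sum>j<n. c i * c j * K (x i) (x j)))"

text \<open>
  The library has no RKHS.  \<open>rkhs K H ip\<close> says that the set of functions \<open>H\<close> with inner product \<open>ip\<close>
  is a Hilbert space with reproducing kernel \<open>K\<close>.  By the Moore--Aronszajn theorem every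
  (symmetric, positive semidefinite) \<open>K\<close> admits exactly one such \<open>H\<close>, and \<open>ip\<close> is determined on \<open>H\<close>;
  the values of \<open>ip\<close> outside \<open>H\<close> play no role.
\<close>

locale rkhs =
  fixes K :: "real \<Rightarrow> real \<Rightarrow> real"
    and H :: "(real \<Rightarrow> real) set"
    and ip :: "(real \<Rightarrow> real) \<Rightarrow> (real \<Rightarrow> real) \<Rightarrow> real"
  assumes zero_mem: "(\<lambda>x. 0) \<in> H"
    and add_mem: "\<lbrakk>f \<in> H; g \<in> H\<rbrakk> \<Longrightarrow> (\<lambda>x. f x + g x) \<in> H"
    and scale_mem: "f \<in> H \<Longrightarrow> (\<lambda>x. c * f x) \<in> H"
    and ip_commute: "\<lbrakk>f \<in> H; g \<in> H\<rbrakk> \<Longrightarrow> ip f g = ip g f"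
    and ip_add: "\<lbrakk>f \<in> H; g \<in> H; h \<in> H\<rbrakk> \<Longrightarrow> ip (\<lambda>x. f x + g x) h = ip f h + ip g h"
    and ip_scale: "\<lbrakk>f \<in> H; g \<in> H\<rbrakk> \<Longrightarrow> ip (\<lambda>x. c * f x) g = c * ip f g"
    and ip_nonneg: "f \<in> H \<Longrightarrow> 0 \<le> ip f f"
    and ip_definite: "\<lbrakk>f \<in> H; ip f f = 0\<rbrakk> \<Longrightarrow> f = (\<lambda>x. 0)"
    and cauchy_complete: "\<lbrakk>\<And>n. F n \<in> H;
        \<And>e. e > 0 \<Longrightarrow> \<exists>M. \<forall>m\<ge>M. \<forall>n\<ge>M.
          sqrt (ip (\<lambda>x. F m x - F n x) (\<lambda>x. F m x - F n x)) < e\<rbrakk>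
      \<Longrightarrow> \<exists>f\<in>H. (\<lambda>n. sqrt (ip (\<lambda>x. F n x - f x) (\<lambda>x. F n x - f x))) \<longlonglongrightarrow> 0"
    and kernel_mem: "K x \<in> H"
    and reproducing: "f \<in> H \<Longrightarrow> ip f (K x) = f x"

definition ip_norm :: "((real \<Rightarrow> real) \<Rightarrow> (real \<Rightarrow> real) \<Rightarrow> real) \<Rightarrow> (real \<Rightarrow> real) \<Rightarrow> real" where
  "ip_norm ip f = sqrt (ip f f)"

text \<open>
  \<open>Ck_square k I F\<close>: \<open>F\<close> is of class C^k on \<open>I \<times> I\<close>, i.e. all partial derivatives of order at most \<open>k\<close>
  exist and are continuous there.  For a closed interval \<open>I\<close> the derivatives at boundary points are the
  one-sided ones.
\<close>

primrec Ck_square :: "nat \<Rightarrow> real set \<Rightarrow> (real \<Rightarrow> real \<Rightarrow> real) \<Rightarrow> bool" where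
  "Ck_square 0 I F \<longleftrightarrow> continuous_on (I \<times> I) (\<lambda>(x, y). F x y)"
| "Ck_square (Suc k) I F \<longleftrightarrow> continuous_on (I \<times> I) (\<lambda>(x, y). F x y) \<and>
     (\<exists>F1 F2.
        (\<forall>x\<in>I. \<forall>y\<in>I.
           ((\<lambda>s. F s y) has_real_derivative F1 x y) (at x within I) \<and>
           ((\<lambda>s. F x s) has_real_derivative F2 x y) (at y within I)) \<and>
        Ck_square k I F1 \<and> Ck_square k I F2)"


section \<open>Observations on the space-time grid\<close>

record observation =
  left_end :: real
  right_end :: real
  horizon :: real
  nx :: nat
  nt :: nat
  dens :: "real \<Rightarrow> real \<Rightarrow> real"

definition \<Omega> :: "observation \<Rightarrow> real set" where
  "\<Omega> S = {left_end S .. right_end S}"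

definition vol :: "observation \<Rightarrow> real" where
  "vol S = right_end S - left_end S"

definition dx :: "observation \<Rightarrow> real" where
  "dx S = vol S / real (nx S)"

definition dt :: "observation \<Rightarrow> real" where
  "dt S = horizon S / real (nt S)"

definition xg :: "observation \<Rightarrow> nat \<Rightarrow> real" where
  "xg S n = left_end S + real n * dx S"

definition tg :: "observation \<Rightarrow> nat \<Rightarrow> real" where
  "tg S l = real l * dt S"

definition prob_density_on :: "real set \<Rightarrow> (real \<Rightarrow> real) \<Rightarrow> bool" where
  "prob_density_on I r \<longleftrightarrow>
     set_integrable lborel I r \<and> (\<forall>x\<in>I. 0 \<le> r x) \<and> (LINT x:I|lborel. r x) = 1"

definition valid_observation :: "observation \<Rightarrow> bool" where
  "valid_observation S \<longleftrightarrow>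
     left_end S < right_end S \<and> 0 < horizon S \<and> 1 \<le> nx S \<and> 1 \<le> nt S \<and>
     (\<forall>t\<in>{0..horizon S}. prob_density_on (\<Omega> S) (dens S t)) \<and>
     (\<forall>l\<in>{1..nt S}. \<forall>n\<in>{1..nx S}. 0 < dens S (tg S l) (xg S n))"

text \<open>The time differences are functions of \<open>x\<close>; at \<open>x = xg S n\<close> they are the grid differences.\<close>

definition dt_plus :: "observation \<Rightarrow> nat \<Rightarrow> real \<Rightarrow> real" where
  "dt_plus S l x =
     (if l < nt S then (dens S (tg S (l + 1)) x - dens S (tg S l) x) / dt S
      else - dens S (tg S l) x / dt S)"

definition dtt_plus :: "observation \<Rightarrow> nat \<Rightarrow> real \<Rightarrow> real" where
  "dtt_plus S l x =
     (if l < nt S then (dt_plus S (l + 1) x - dt_plus S l x) / dt S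
      else - dt_plus S l x / dt S)"

definition dx_plus :: "observation \<Rightarrow> nat \<Rightarrow> nat \<Rightarrow> real" where
  "dx_plus S l n =
     (if n < nx S then (dens S (tg S l) (xg S (n + 1)) - dens S (tg S l) (xg S n)) / dx S
      else - dens S (tg S l) (xg S n) / dx S)"


section \<open>Differential operators\<close>

text \<open>
  Derivative relative to \<open>I\<close>: the usual one at interior points of an interval, one-sided at its end
  points.  This is needed since the last grid point is the right end of \<open>\<Omega>\<close>.
\<close>

definition deriv_on :: "real set \<Rightarrow> (real \<Rightarrow> real) \<Rightarrow> real \<Rightarrow> real" where
  "deriv_on I g x = vector_derivative g (at x within I)"

definition D_op :: "observation \<Rightarrow> nat \<Rightarrow> nat \<Rightarrow> (real \<Rightarrow> real) \<Rightarrow> real" where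
  "D_op S l n g =
     dx_plus S l n * deriv_on (\<Omega> S) g (xg S n) +
     dens S (tg S l) (xg S n) * deriv_on (\<Omega> S) (deriv_on (\<Omega> S) g) (xg S n)"

text \<open>Densities live on \<open>\<Omega>\<close>, so all convolution integrals are over \<open>\<Omega>\<close>.\<close>

definition conv_fun :: "observation \<Rightarrow> nat \<Rightarrow> (real \<Rightarrow> real) \<Rightarrow> real \<Rightarrow> real" where
  "conv_fun S l \<psi> x = (LINT z:\<Omega> S|lborel. \<psi> (x - z) * dens S (tg S l) z)"

definition conv_ker :: "observation \<Rightarrow> nat \<Rightarrow> (real \<Rightarrow> real \<Rightarrow> real) \<Rightarrow> real \<Rightarrow> real \<Rightarrow> real" where
  "conv_ker S l K x y = (LINT z:\<Omega> S|lborel. K (x - z) y * dens S (tg S l) z)"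

definition conv_ker2 ::
  "observation \<Rightarrow> nat \<Rightarrow> nat \<Rightarrow> (real \<Rightarrow> real \<Rightarrow> real) \<Rightarrow> real \<Rightarrow> real \<Rightarrow> real" where
  "conv_ker2 S l k K x y =
     (LINT z1:\<Omega> S|lborel. (LINT z2:\<Omega> S|lborel.
        K (x - z1) (y - z2) * dens S (tg S l) z1 * dens S (tg S k) z2))"

definition A_op :: "observation \<Rightarrow> (real \<Rightarrow> real) \<Rightarrow> (real \<Rightarrow> real) \<Rightarrow> nat \<Rightarrow> nat \<Rightarrow> real" where
  "A_op S \<phi> \<psi> l n = D_op S l n (\<lambda>x. \<phi> x + conv_fun S l \<psi> x)"


section \<open>The data\<close>

definition wlap :: "real set \<Rightarrow> (real \<Rightarrow> real) \<Rightarrow> (real \<Rightarrow> real) \<Rightarrow> real \<Rightarrow> real" where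
  "wlap I r g = deriv_on I (\<lambda>y. r y * deriv_on I g y)"

text \<open>
  Domain of the weighted Laplacian on \<open>{a..b}\<close> as an operator in L2: no-flux boundary conditions, which
  make it symmetric.
\<close>

definition wlap_dom :: "real \<Rightarrow> real \<Rightarrow> (real \<Rightarrow> real) \<Rightarrow> (real \<Rightarrow> real) set" where
  "wlap_dom a b r = {g.
     (\<forall>x\<in>{a..b}. g differentiable (at x within {a..b})) \<and>
     (\<forall>x\<in>{a..b}. (\<lambda>y. r y * deriv_on {a..b} g y) differentiable (at x within {a..b})) \<and>
     r a * deriv_on {a..b} g a = 0 \<and> r b * deriv_on {a..b} g b = 0}"

definition L2_sq :: "real set \<Rightarrow> (real \<Rightarrow> real) \<Rightarrow> ennreal" where
  "L2_sq I f = (\<integral>\<^sup>+x\<in>I. ennreal ((f x)\<^sup>2) \<partial>lborel)"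

definition wlap_least_squares ::
  "real \<Rightarrow> real \<Rightarrow> (real \<Rightarrow> real) \<Rightarrow> (real \<Rightarrow> real) \<Rightarrow> (real \<Rightarrow> real) \<Rightarrow> bool" where
  "wlap_least_squares a b r \<sigma> =
     is_arg_min (\<lambda>g. L2_sq {a..b} (\<lambda>x. wlap {a..b} r g x - \<sigma> x)) (\<lambda>g. g \<in> wlap_dom a b r)"

text \<open>
  Moore--Penrose pseudo-inverse: the least-squares solution of minimal L2 norm.  It is determined on
  \<open>{a..b}\<close> only; its values elsewhere are never used.  For \<open>\<sigma>\<close> of mean zero it solves the weighted Poisson
  equation; the case \<open>l = nt S\<close> of \<open>dt_plus\<close> is not of mean zero.
\<close>

definition wlap_pinv ::
  "real \<Rightarrow> real \<Rightarrow> (real \<Rightarrow> real) \<Rightarrow> (real \<Rightarrow> real) \<Rightarrow> real \<Rightarrow> real" where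
  "wlap_pinv a b r \<sigma> = arg_min (L2_sq {a..b}) (wlap_least_squares a b r \<sigma>)"

definition Gamma_W ::
  "real \<Rightarrow> real \<Rightarrow> (real \<Rightarrow> real) \<Rightarrow> (real \<Rightarrow> real) \<Rightarrow> real \<Rightarrow> real" where
  "Gamma_W a b r \<sigma> x =
     - (wlap {a..b} \<sigma> (wlap_pinv a b r \<sigma>) x +
        1 / 2 * wlap {a..b} r (\<lambda>y. (deriv_on {a..b} (wlap_pinv a b r \<sigma>) y)\<^sup>2) x)"

text \<open>
  \<open>data\<close> is the vector f of right-hand sides.  The spatial derivatives of \<open>U'(\<rho>)\<close> are those of the function
  \<open>y \<mapsto> U'(\<rho>(t, y))\<close>; the argument of \<open>Gamma_W\<close> is the forward time difference as a function of \<open>x\<close>.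
\<close>

datatype flow = Gradient_flow | Hamiltonian_flow

definition data :: "observation \<Rightarrow> flow \<Rightarrow> (real \<Rightarrow> real) \<Rightarrow> nat \<Rightarrow> nat \<Rightarrow> real" where
  "data S fl U l n =
     (let r = dens S (tg S l); x = xg S n; p = (\<lambda>y. deriv U (r y)) in
      (case fl of
         Gradient_flow \<Rightarrow> dt_plus S l x
       | Hamiltonian_flow \<Rightarrow>
           dtt_plus S l x + Gamma_W (left_end S) (right_end S) r (dt_plus S l) x)
      - dx_plus S l n * deriv_on (\<Omega> S) p x - r x * deriv_on (\<Omega> S) (deriv_on (\<Omega> S) p) x)"


section \<open>Regularized loss\<close>

definition reg_loss ::
  "observation \<Rightarrow> flow \<Rightarrow> (real \<Rightarrow> real) \<Rightarrow> real \<Rightarrow> real \<Rightarrow>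
   ((real \<Rightarrow> real) \<Rightarrow> (real \<Rightarrow> real) \<Rightarrow> real) \<Rightarrow> ((real \<Rightarrow> real) \<Rightarrow> (real \<Rightarrow> real) \<Rightarrow> real) \<Rightarrow>
   (real \<Rightarrow> real) \<Rightarrow> (real \<Rightarrow> real) \<Rightarrow> real" where
  "reg_loss S fl U lam1 lam2 ip1 ip2 \<phi> \<psi> =
     horizon S * vol S / (real (nx S) * real (nt S)) *
       (\<Sum>l=1..nt S. \<Sum>n=1..nx S.
          \<bar>A_op S \<phi> \<psi> l n - data S fl U l n\<bar>\<^sup>2 * dens S (tg S l) (xg S n))
     + lam1 * (ip_norm ip1 \<phi>)\<^sup>2 + lam2 * (ip_norm ip2 \<psi>)\<^sup>2"

definition is_minimizer ::
  "observation \<Rightarrow> flow \<Rightarrow> (real \<Rightarrow> real) \<Rightarrow> real \<Rightarrow> real \<Rightarrow>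
   (real \<Rightarrow> real) set \<Rightarrow> ((real \<Rightarrow> real) \<Rightarrow> (real \<Rightarrow> real) \<Rightarrow> real) \<Rightarrow>
   (real \<Rightarrow> real) set \<Rightarrow> ((real \<Rightarrow> real) \<Rightarrow> (real \<Rightarrow> real) \<Rightarrow> real) \<Rightarrow>
   (real \<Rightarrow> real) \<times> (real \<Rightarrow> real) \<Rightarrow> bool" where
  "is_minimizer S fl U lam1 lam2 H1 ip1 H2 ip2 =
     is_arg_min (\<lambda>(\<phi>, \<psi>). reg_loss S fl U lam1 lam2 ip1 ip2 \<phi> \<psi>) (\<lambda>p. p \<in> H1 \<times> H2)"


section \<open>Vectors and matrices indexed by the grid\<close>

text \<open>
  Position \<open>i < nt S * nx S\<close> (counted from 0) stands for the pair \<open>(ti S i, xi S i)\<close> (counted from 1),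
  time being the slow index.
\<close>

definition grid_dim :: "observation \<Rightarrow> nat" where
  "grid_dim S = nx S * nt S"

definition ti :: "observation \<Rightarrow> nat \<Rightarrow> nat" where
  "ti S i = i div nx S + 1"

definition xi :: "observation \<Rightarrow> nat \<Rightarrow> nat" where
  "xi S i = i mod nx S + 1"

definition D_at :: "observation \<Rightarrow> nat \<Rightarrow> (real \<Rightarrow> real) \<Rightarrow> real" where
  "D_at S i = D_op S (ti S i) (xi S i)"

definition C_rho :: "observation \<Rightarrow> real Matrix.mat" where
  "C_rho S = mat_diag (grid_dim S) (\<lambda>i. dens S (tg S (ti S i)) (xg S (xi S i)))"

definition inner_C :: "observation \<Rightarrow> real Matrix.vec \<Rightarrow> real Matrix.vec \<Rightarrow> real" where
  "inner_C S u v = u \<bullet> (C_rho S *\<^sub>v v)"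

definition data_vec :: "observation \<Rightarrow> flow \<Rightarrow> (real \<Rightarrow> real) \<Rightarrow> real Matrix.vec" where
  "data_vec S fl U = Matrix.vec (grid_dim S) (\<lambda>i. data S fl U (ti S i) (xi S i))"

text \<open>The vectors of functions, evaluated at \<open>y\<close>.\<close>

definition Delta10 :: "observation \<Rightarrow> (real \<Rightarrow> real \<Rightarrow> real) \<Rightarrow> real \<Rightarrow> real Matrix.vec" where
  "Delta10 S K y = Matrix.vec (grid_dim S) (\<lambda>i. D_at S i (\<lambda>x. K x y))"

definition Delta10_conv :: "observation \<Rightarrow> (real \<Rightarrow> real \<Rightarrow> real) \<Rightarrow> real \<Rightarrow> real Matrix.vec" where
  "Delta10_conv S K y = Matrix.vec (grid_dim S) (\<lambda>i. D_at S i (\<lambda>x. conv_ker S (ti S i) K x y))"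

definition Delta11 :: "observation \<Rightarrow> (real \<Rightarrow> real \<Rightarrow> real) \<Rightarrow> real Matrix.mat" where
  "Delta11 S K = Matrix.mat (grid_dim S) (grid_dim S)
     (\<lambda>(i, j). D_at S i (\<lambda>x. D_at S j (\<lambda>y. K x y)))"

definition Delta11_conv :: "observation \<Rightarrow> (real \<Rightarrow> real \<Rightarrow> real) \<Rightarrow> real Matrix.mat" where
  "Delta11_conv S K = Matrix.mat (grid_dim S) (grid_dim S)
     (\<lambda>(i, j). D_at S i (\<lambda>x. D_at S j (\<lambda>y. conv_ker2 S (ti S i) (ti S j) K x y)))"

definition gram ::
  "observation \<Rightarrow> (real \<Rightarrow> real \<Rightarrow> real) \<Rightarrow> (real \<Rightarrow> real \<Rightarrow> real) \<Rightarrow> real \<Rightarrow> real \<Rightarrow> real Matrix.mat" where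
  "gram S K1 K2 lam1 lam2 =
     C_rho S * (lam2 \<cdot>\<^sub>m Delta11 S K1 + lam1 \<cdot>\<^sub>m Delta11_conv S K2) * C_rho S"

definition system_mat ::
  "observation \<Rightarrow> (real \<Rightarrow> real \<Rightarrow> real) \<Rightarrow> (real \<Rightarrow> real \<Rightarrow> real) \<Rightarrow> real \<Rightarrow> real \<Rightarrow> real Matrix.mat" where
  "system_mat S K1 K2 lam1 lam2 =
     gram S K1 K2 lam1 lam2 +
     (lam1 * lam2 * (real (nx S) * real (nt S)) / (horizon S * vol S)) \<cdot>\<^sub>m C_rho S"

text \<open>Only meaningful for invertible \<open>A\<close>: \<open>mat_inverse A\<close> is \<open>Some B\<close>, with \<open>B\<close> the inverse of \<open>A\<close>.\<close>

definition inv_mat :: "real Matrix.mat \<Rightarrow> real Matrix.mat" where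
  "inv_mat A = the (mat_inverse A)"

definition C1_hat ::
  "observation \<Rightarrow> flow \<Rightarrow> (real \<Rightarrow> real) \<Rightarrow> (real \<Rightarrow> real \<Rightarrow> real) \<Rightarrow> (real \<Rightarrow> real \<Rightarrow> real) \<Rightarrow>
   real \<Rightarrow> real \<Rightarrow> real Matrix.vec" where
  "C1_hat S fl U K1 K2 lam1 lam2 =
     lam2 \<cdot>\<^sub>v (inv_mat (system_mat S K1 K2 lam1 lam2) *\<^sub>v (C_rho S *\<^sub>v data_vec S fl U))"

definition C2_hat ::
  "observation \<Rightarrow> flow \<Rightarrow> (real \<Rightarrow> real) \<Rightarrow> (real \<Rightarrow> real \<Rightarrow> real) \<Rightarrow> (real \<Rightarrow> real \<Rightarrow> real) \<Rightarrow>
   real \<Rightarrow> real \<Rightarrow> real Matrix.vec" where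
  "C2_hat S fl U K1 K2 lam1 lam2 =
     lam1 \<cdot>\<^sub>v (inv_mat (system_mat S K1 K2 lam1 lam2) *\<^sub>v (C_rho S *\<^sub>v data_vec S fl U))"

end

theory Submission
  imports Defs "Jordan_Normal_Form.Determinant"
begin

text \<open>
  The loss is a regularized least squares functional on the product of two Hilbert spaces, and its data are
  finitely many numbers depending linearly on \<open>(\<phi>, \<psi>)\<close>.  Once these functionals are known to be bounded, they
  have representers \<open>p i\<close> and \<open>r i\<close>, that is
  \<open>A\<^sup>\<delta>(\<phi>, \<psi>)(t\<^sub>l, x\<^sub>n) = \<langle>p i, \<phi>\<rangle> + \<langle>r i, \<psi>\<rangle>\<close> for the position \<open>i\<close> of \<open>(l, n)\<close>, and the rest is linear algebra.

  The functionals are bounded because the kernels are of class \<open>C\<^sup>4\<close>.  If a map \<open>\<Phi>\<close> into a Hilbert space has a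
  Gram kernel of class \<open>C\<^sup>2\<close>, its difference quotients are Cauchy in norm by the mean value theorem, so the
  derivatives of all functions \<open>x \<mapsto> \<langle>f, \<Phi> x\<rangle>\<close> are represented by a new map, whose Gram kernel is the mixed
  derivative (\<open>feature_derivative\<close>).  Two applications to \<open>x \<mapsto> K x\<close> represent the first and second derivatives of
  the elements of the space.  For the interaction term, differentiation passes under the convolution
  (\<open>convolution_derivative\<close>), and integrating the functionals against a probability density keeps them bounded
  (\<open>convolution_representer\<close>).  The Riesz representation theorem is proved for this purpose
  (\<open>riesz_representation\<close>).

  By the reproducing property, the vectors of functions in the statement have the entries \<open>p i\<close> and \<open>r i\<close>, and the
  two matrices have the entries \<open>\<langle>p i, p j\<rangle>\<close> and \<open>\<langle>r i, r j\<rangle>\<close> (\<open>D_op_D_op_kernel\<close>, \<open>D_op_D_op_conv_kernel\<close>).  The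
  system matrix is therefore a positive semidefinite matrix plus a positive multiple of \<open>C_rho\<close>, which is
  positive definite; hence it is invertible.  The coefficients solving the system satisfy the normal equations, and the
  loss grows at least like \<open>lam1 * \<parallel>\<phi> - V\<parallel>\<^sup>2 + lam2 * \<parallel>\<psi> - W\<parallel>\<^sup>2\<close> away from the resulting pair \<open>(V, W)\<close>
  (\<open>regularized_least_squares_minimizer\<close>).
\<close>

section \<open>Two facts about real numbers\<close>

lemma vanishing_of_nonneg_quadratic:
  fixes d B :: real
  assumes "0 \<le> B" and "\<And>t. 0 \<le> 2 * t * d + t\<^sup>2 * B"
  shows "d = 0"
proof (rule ccontr)
  assume "d \<noteq> 0"
  define t where "t = - d / (B + 1)"
  have d: "d = - (t * (B + 1))" using assms(1) by (simp add: t_def)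
  have "t \<noteq> 0" using \<open>d \<noteq> 0\<close> d by auto
  have "2 * t * d + t\<^sup>2 * B = - (t\<^sup>2 * (B + 2))"
    by (simp add: d power2_eq_square algebra_simps)
  moreover have "0 < t\<^sup>2 * (B + 2)" using \<open>t \<noteq> 0\<close> assms(1) by simp
  ultimately show False using assms(2)[of t] by linarith
qed

text \<open>
  With \<open>u\<close>, \<open>w\<close>, \<open>v\<close> the inner products \<open>\<langle>f, f\<rangle>\<close>, \<open>\<langle>f, g\<rangle>\<close>, \<open>\<langle>g, g\<rangle>\<close> and \<open>p = L f\<close>, \<open>q = L g\<close>: if \<open>f\<close> and \<open>g\<close> come
  within \<open>a\<close> and \<open>b\<close> of the infimum \<open>m\<close> of \<open>\<parallel>f\<parallel>\<^sup>2 - 2 L f\<close>, then \<open>\<parallel>f - g\<parallel>\<^sup>2\<close> is at most \<open>2 a + 2 b\<close>, because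
  the midpoint of \<open>f\<close> and \<open>g\<close> does not go below \<open>m\<close>.
\<close>

lemma parallelogram_bound:
  fixes m :: real
  shows "m \<le> 1/4 * (u + 2 * w + v) - p - q \<Longrightarrow> u - 2 * p < m + a \<Longrightarrow> v - 2 * q < m + b
    \<Longrightarrow> u - 2 * w + v \<le> 2 * a + 2 * b"
  by (simp add: field_simps)

section \<open>Hilbert space geometry of a reproducing kernel Hilbert space\<close>

context rkhs
begin

lemma axpy_mem: "\<lbrakk>f \<in> H; g \<in> H\<rbrakk> \<Longrightarrow> (\<lambda>x. f x + c * g x) \<in> H"
  using add_mem scale_mem by simp

lemma ip_axpy_left:
  "\<lbrakk>f \<in> H; g \<in> H; h \<in> H\<rbrakk> \<Longrightarrow> ip (\<lambda>x. f x + c * g x) h = ip f h + c * ip g h"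
  using ip_add[of f "\<lambda>x. c * g x" h] ip_scale[of g h c] scale_mem by simp

lemma ip_axpy_right:
  "\<lbrakk>f \<in> H; g \<in> H; h \<in> H\<rbrakk> \<Longrightarrow> ip h (\<lambda>x. f x + c * g x) = ip h f + c * ip h g"
  using ip_axpy_left[of f g h c] ip_commute axpy_mem by metis

lemma diff_mem: "\<lbrakk>f \<in> H; g \<in> H\<rbrakk> \<Longrightarrow> (\<lambda>x. f x - g x) \<in> H"
  using axpy_mem[of f g "-1"] by simp

lemma ip_scale_right: "\<lbrakk>f \<in> H; g \<in> H\<rbrakk> \<Longrightarrow> ip g (\<lambda>x. c * f x) = c * ip g f"
  using ip_scale[of f g c] ip_commute scale_mem by metis

lemma ip_diff_left:
  "\<lbrakk>f \<in> H; g \<in> H; h \<in> H\<rbrakk> \<Longrightarrow> ip (\<lambda>x. f x - g x) h = ip f h - ip g h"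
  using ip_axpy_left[of f g h "-1"] by simp

lemma ip_diff_right:
  "\<lbrakk>f \<in> H; g \<in> H; h \<in> H\<rbrakk> \<Longrightarrow> ip h (\<lambda>x. f x - g x) = ip h f - ip h g"
  using ip_axpy_right[of f g h "-1"] by simp

lemma ip_axpy_self:
  "\<lbrakk>f \<in> H; g \<in> H\<rbrakk> \<Longrightarrow>
    ip (\<lambda>x. f x + c * g x) (\<lambda>x. f x + c * g x) = ip f f + 2 * c * ip f g + c\<^sup>2 * ip g g"
  using ip_commute[of f g]
  by (simp add: ip_axpy_left ip_axpy_right axpy_mem power2_eq_square algebra_simps)

lemma ip_diff_self:
  "\<lbrakk>f \<in> H; g \<in> H\<rbrakk> \<Longrightarrow>
    ip (\<lambda>x. f x - g x) (\<lambda>x. f x - g x) = ip f f - 2 * ip f g + ip g g"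
  using ip_axpy_self[of f g "-1"] by simp

lemma sum_mem: "(\<And>i. i \<in> A \<Longrightarrow> f i \<in> H) \<Longrightarrow> (\<lambda>x. \<Sum>i\<in>A. c i * f i x) \<in> H"
proof (induction A rule: infinite_finite_induct)
  case (insert i A)
  then show ?case
    using axpy_mem[of "\<lambda>x. \<Sum>i\<in>A. c i * f i x" "f i" "c i"] by (simp add: add.commute)
qed (simp_all add: zero_mem)

lemma ip_zero_left: "f \<in> H \<Longrightarrow> ip (\<lambda>x. 0) f = 0"
  using ip_scale[of f f 0] by simp

lemma ip_sum_left:
  "\<lbrakk>\<And>i. i \<in> A \<Longrightarrow> f i \<in> H; g \<in> H\<rbrakk> \<Longrightarrow>
    ip (\<lambda>x. \<Sum>i\<in>A. c i * f i x) g = (\<Sum>i\<in>A. c i * ip (f i) g)"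
proof (induction A rule: infinite_finite_induct)
  case (insert i A)
  then show ?case
    using ip_axpy_left[of "\<lambda>x. \<Sum>i\<in>A. c i * f i x" "f i" g "c i"] sum_mem[of A f c]
    by (simp add: add.commute)
qed (simp_all add: ip_zero_left)

lemma cauchy_schwarz:
  assumes "f \<in> H" "g \<in> H"
  shows "\<bar>ip f g\<bar> \<le> sqrt (ip f f) * sqrt (ip g g)"
proof (cases "ip g g = 0")
  case True
  then have "g = (\<lambda>x. 0)" using ip_definite assms by blast
  then have "ip f g = 0" using ip_zero_left ip_commute zero_mem assms by metis
  then show ?thesis by (simp add: True)
next
  case False
  then have pos: "0 < ip g g" using ip_nonneg[OF assms(2)] by simp
  have "0 \<le> ip f f + 2 * (- ip f g / ip g g) * ip f g + (- ip f g / ip g g)\<^sup>2 * ip g g"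
    using ip_nonneg[OF axpy_mem[OF assms]] ip_axpy_self[OF assms] by metis
  also have "\<dots> = ip f f - (ip f g)\<^sup>2 / ip g g"
    using pos by (simp add: field_simps power2_eq_square)
  finally have "(ip f g)\<^sup>2 \<le> ip f f * ip g g" using pos by (simp add: field_simps)
  then have "sqrt ((ip f g)\<^sup>2) \<le> sqrt (ip f f * ip g g)" by (rule real_sqrt_le_mono)
  then show ?thesis by (simp add: real_sqrt_mult)
qed

text \<open>
  The Riesz representation theorem.  The representer is the minimizer of
  \<open>J f = \<parallel>f\<parallel>\<^sup>2 - 2 L f\<close>: by the parallelogram law a minimizing sequence is Cauchy, and the first variation
  of \<open>J\<close> vanishes at its limit.
\<close>

lemma riesz_representation:
  assumes add: "\<And>f g. \<lbrakk>f \<in> H; g \<in> H\<rbrakk> \<Longrightarrow> L (\<lambda>x. f x + g x) = L f + L g"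
    and scale: "\<And>c f. f \<in> H \<Longrightarrow> L (\<lambda>x. c * f x) = c * L f"
    and bound: "\<And>f. f \<in> H \<Longrightarrow> \<bar>L f\<bar> \<le> C * sqrt (ip f f)"
  obtains r where "r \<in> H" "\<And>f. f \<in> H \<Longrightarrow> L f = ip r f"
proof -
  define J where "J f = ip f f - 2 * L f" for f
  have L_axpy: "L (\<lambda>x. f x + c * g x) = L f + c * L g" if "f \<in> H" "g \<in> H" for f g c
    using add[of f "\<lambda>x. c * g x"] scale[of g c] scale_mem that by simp
  have J_lower: "- C\<^sup>2 \<le> J f" if "f \<in> H" for f
  proof -
    have "0 \<le> (sqrt (ip f f) - C)\<^sup>2" by simp
    also have "\<dots> = ip f f - 2 * (C * sqrt (ip f f)) + C\<^sup>2"
      using ip_nonneg[OF that] by (simp add: power2_diff)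
    finally show ?thesis using bound[OF that] by (simp add: J_def)
  qed
  define m where "m = Inf (J ` H)"
  have bdd: "bdd_below (J ` H)" using J_lower by (auto intro!: bdd_belowI[of _ "- C\<^sup>2"])
  have m_le: "m \<le> J f" if "f \<in> H" for f
    unfolding m_def using bdd that by (simp add: cInf_lower)
  have "\<exists>f\<in>H. J f < m + 1 / real (Suc n)" for n
  proof -
    have "Inf (J ` H) < m + 1 / real (Suc n)" by (simp add: m_def)
    then show ?thesis using cInf_lessD[of "J ` H"] zero_mem by blast
  qed
  then obtain F where F: "\<And>n. F n \<in> H" and JF: "\<And>n. J (F n) < m + 1 / real (Suc n)"
    by metis
  have gap: "ip (\<lambda>x. F i x - F j x) (\<lambda>x. F i x - F j x) \<le> 2 * (1 / real (Suc i)) + 2 * (1 / real (Suc j))"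
    for i j
  proof -
    \<comment> \<open>The factor 1 gives the sum the shape \<open>f x + c * g x\<close> of the expansion lemmas.\<close>
    have "m \<le> J (\<lambda>x. (1/2) * (F i x + 1 * F j x))"
      by (intro m_le scale_mem axpy_mem F)
    also have "\<dots> = (1/4) * ip (\<lambda>x. F i x + 1 * F j x) (\<lambda>x. F i x + 1 * F j x)
        - L (\<lambda>x. F i x + 1 * F j x)"
      using scale[OF axpy_mem[OF F F, of i 1 j], of "1/2"]
        ip_scale[OF axpy_mem[OF F F, of i 1 j] scale_mem[OF axpy_mem[OF F F, of i 1 j]], of "1/2" "1/2"]
        ip_scale[OF axpy_mem[OF F F, of i 1 j] axpy_mem[OF F F, of i 1 j], of "1/2"]
        ip_commute[OF axpy_mem[OF F F, of i 1 j] scale_mem[OF axpy_mem[OF F F, of i 1 j], of "1/2"]]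
      by (simp add: J_def)
    also have "\<dots> = (1/4) * (ip (F i) (F i) + 2 * ip (F i) (F j) + ip (F j) (F j)) - L (F i) - L (F j)"
      using ip_axpy_self[OF F F, of i 1 j] L_axpy[OF F F, of i 1 j] by simp
    finally have "m \<le> (1/4) * (ip (F i) (F i) + 2 * ip (F i) (F j) + ip (F j) (F j)) - L (F i) - L (F j)" .
    moreover have "ip (F i) (F i) - 2 * L (F i) < m + 1 / real (Suc i)"
      "ip (F j) (F j) - 2 * L (F j) < m + 1 / real (Suc j)"
      using JF[of i] JF[of j] unfolding J_def by blast+
    ultimately show ?thesis
      unfolding ip_diff_self[OF F F] by (rule parallelogram_bound)
  qed
  have "\<exists>f\<in>H. (\<lambda>n. sqrt (ip (\<lambda>x. F n x - f x) (\<lambda>x. F n x - f x))) \<longlonglongrightarrow> 0"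
  proof (rule cauchy_complete[OF F])
    fix e :: real
    assume "e > 0"
    then obtain M where M: "inverse (real (Suc M)) < e\<^sup>2 / 4"
      using reals_Archimedean[of "e\<^sup>2 / 4"] by auto
    have "sqrt (ip (\<lambda>x. F i x - F j x) (\<lambda>x. F i x - F j x)) < e" if "M \<le> i" "M \<le> j" for i j
    proof -
      have inv: "1 / real (Suc k) < e\<^sup>2 / 4" if "M \<le> k" for k
      proof -
        have "1 / real (Suc k) \<le> 1 / real (Suc M)" using that by (intro divide_left_mono) auto
        then show ?thesis using M by (simp add: inverse_eq_divide)
      qed
      have "ip (\<lambda>x. F i x - F j x) (\<lambda>x. F i x - F j x) < e\<^sup>2"
        using gap[of i j] inv[OF that(1)] inv[OF that(2)] by simp
      then have "sqrt (ip (\<lambda>x. F i x - F j x) (\<lambda>x. F i x - F j x)) < sqrt (e\<^sup>2)"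
        by (rule real_sqrt_less_mono)
      then show ?thesis using \<open>e > 0\<close> by simp
    qed
    then show "\<exists>M. \<forall>i\<ge>M. \<forall>j\<ge>M. sqrt (ip (\<lambda>x. F i x - F j x) (\<lambda>x. F i x - F j x)) < e"
      by blast
  qed
  then obtain r where r: "r \<in> H"
    and lim: "(\<lambda>n. sqrt (ip (\<lambda>x. F n x - r x) (\<lambda>x. F n x - r x))) \<longlonglongrightarrow> 0" by blast
  have "L g = ip r g" if g: "g \<in> H" for g
  proof -
    have "(\<lambda>n. ip (F n) g - ip r g) \<longlonglongrightarrow> 0"
    proof (rule Lim_null_comparison)
      show "\<forall>\<^sub>F n in sequentially. norm (ip (F n) g - ip r g)
          \<le> sqrt (ip (\<lambda>x. F n x - r x) (\<lambda>x. F n x - r x)) * sqrt (ip g g)"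
        using cauchy_schwarz[OF diff_mem[OF F r] g] by (simp add: ip_diff_left F r g)
      show "(\<lambda>n. sqrt (ip (\<lambda>x. F n x - r x) (\<lambda>x. F n x - r x)) * sqrt (ip g g)) \<longlonglongrightarrow> 0"
        using tendsto_mult_left_zero[OF lim] .
    qed
    then have ipF: "(\<lambda>n. ip (F n) g) \<longlonglongrightarrow> ip r g" by (rule LIM_zero_cancel)
    \<comment> \<open>The first variation at \<open>F n\<close> in direction \<open>g\<close>, in the limit.\<close>
    have var: "0 \<le> 2 * t * (ip r g - L g) + t\<^sup>2 * ip g g" for t
    proof -
      have "0 \<le> 2 * t * (ip (F n) g - L g) + t\<^sup>2 * ip g g + inverse (real (Suc n))" for n
        using m_le[OF axpy_mem[OF F g], of n t] JF[of n]
        by (simp add: J_def ip_axpy_self[OF F g] L_axpy[OF F g] algebra_simps inverse_eq_divide)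
      moreover have "(\<lambda>n. 2 * t * (ip (F n) g - L g) + t\<^sup>2 * ip g g + inverse (real (Suc n)))
          \<longlonglongrightarrow> 2 * t * (ip r g - L g) + t\<^sup>2 * ip g g + 0"
        by (intro tendsto_intros ipF LIMSEQ_inverse_real_of_nat)
      ultimately show ?thesis by (intro LIMSEQ_le_const[where a = 0]) auto
    qed
    have "ip r g - L g = 0"
      using vanishing_of_nonneg_quadratic[OF ip_nonneg[OF g] var] by simp
    then show ?thesis by simp
  qed
  with r that show ?thesis by blast
qed

end

section \<open>Calculus on a compact interval\<close>

lemma at_within_Icc_neq_bot:
  fixes a b x :: real
  assumes "a < b" "x \<in> {a..b}"
  shows "at x within {a..b} \<noteq> bot"
  using assms by (simp add: trivial_limit_within islimpt_Icc)

lemma real_derivative_unique_Icc: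
  fixes g :: "real \<Rightarrow> real"
  assumes "a < b" "x \<in> {a..b}"
    and "(g has_real_derivative u) (at x within {a..b})"
    and "(h has_real_derivative v) (at x within {a..b})"
    and "\<And>s. s \<in> {a..b} \<Longrightarrow> g s = h s"
  shows "u = v"
proof -
  have "(g has_real_derivative v) (at x within {a..b})"
    using assms(4)
    by (rule has_field_derivative_transform_within[where d = 1]) (use assms(2,5) in auto)
  then show ?thesis
    using vector_derivative_unique_within[OF at_within_Icc_neq_bot[OF assms(1,2)]] assms(3)
    by (simp add: has_real_derivative_iff_has_vector_derivative)
qed

text \<open>
  A mean value theorem for one-sided derivatives at the end points, with \<open>u\<close> and \<open>v\<close> in either order;
  the intermediate point is only claimed to be no further from \<open>u\<close> than \<open>v\<close> is.
\<close>

lemma mean_value_Icc: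
  fixes g :: "real \<Rightarrow> real"
  assumes deriv: "\<And>x. x \<in> {a..b} \<Longrightarrow> (g has_real_derivative g' x) (at x within {a..b})"
    and u: "u \<in> {a..b}" and v: "v \<in> {a..b}"
  obtains \<xi> where "\<xi> \<in> {a..b}" "\<bar>\<xi> - u\<bar> \<le> \<bar>v - u\<bar>" "g v - g u = g' \<xi> * (v - u)"
proof -
  have *: "\<exists>\<xi>\<in>{p..q}. g q - g p = g' \<xi> * (q - p)" if "a \<le> p" "p \<le> q" "q \<le> b" for p q
  proof (rule mvt_very_simple[OF \<open>p \<le> q\<close>, of g "\<lambda>x. (*) (g' x)"])
    fix x
    assume "p \<le> x" "x \<le> q"
    then have "(g has_real_derivative g' x) (at x within {p..q})"
      using that by (intro DERIV_subset[OF deriv]) auto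
    then show "(g has_derivative (*) (g' x)) (at x within {p..q})"
      by (simp add: has_field_derivative_def)
  qed
  show ?thesis
  proof (cases "u \<le> v")
    case True
    with *[of u v] u v obtain \<xi> where "\<xi> \<in> {u..v}" "g v - g u = g' \<xi> * (v - u)" by auto
    with that[of \<xi>] u v show ?thesis by auto
  next
    case False
    with *[of v u] u v obtain \<xi> where "\<xi> \<in> {v..u}" "g u - g v = g' \<xi> * (u - v)" by auto
    with that[of \<xi>] u v show ?thesis by (auto simp: algebra_simps)
  qed
qed

lemma tendsto_of_cauchy_within:
  fixes F :: "real \<Rightarrow> real"
  assumes nontriv: "at x within I \<noteq> bot"
    and cauchy: "\<And>e. e > 0 \<Longrightarrow> \<exists>d>0. \<forall>s\<in>I - {x}. \<forall>t\<in>I - {x}.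
      \<bar>s - x\<bar> < d \<longrightarrow> \<bar>t - x\<bar> < d \<longrightarrow> \<bar>F s - F t\<bar> < e"
  obtains l where "(F \<longlongrightarrow> l) (at x within I)"
proof -
  have "cauchy_filter (filtermap F (at x within I))"
    unfolding cauchy_filter_metric_filtermap
  proof (intro allI impI)
    fix e :: real
    assume "e > 0"
    then obtain d where "d > 0" and d: "\<forall>s\<in>I - {x}. \<forall>t\<in>I - {x}.
        \<bar>s - x\<bar> < d \<longrightarrow> \<bar>t - x\<bar> < d \<longrightarrow> \<bar>F s - F t\<bar> < e"
      using cauchy by blast
    show "\<exists>P. eventually P (at x within I) \<and> (\<forall>s t. P s \<and> P t \<longrightarrow> dist (F s) (F t) < e)"
    proof (intro exI[of _ "\<lambda>s. s \<in> I - {x} \<and> \<bar>s - x\<bar> < d"] conjI)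
      show "\<forall>\<^sub>F s in at x within I. s \<in> I - {x} \<and> \<bar>s - x\<bar> < d"
        using \<open>d > 0\<close> by (auto simp: eventually_at dist_real_def)
      show "\<forall>s t. (s \<in> I - {x} \<and> \<bar>s - x\<bar> < d) \<and> t \<in> I - {x} \<and> \<bar>t - x\<bar> < d
          \<longrightarrow> dist (F s) (F t) < e"
        using d by (simp add: dist_real_def)
    qed
  qed
  then have "\<exists>l. filtermap F (at x within I) \<le> nhds l"
    using cauchy_filter_complete_converges[of "filtermap F (at x within I)" "UNIV :: real set"]
      complete_UNIV nontriv by (simp add: filtermap_bot_iff)
  then show ?thesis using that by (auto simp: filterlim_def)
qed

lemma Ck_square_imp_continuous: "Ck_square k I F \<Longrightarrow> continuous_on (I \<times> I) (\<lambda>(x, y). F x y)"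
  by (cases k) auto

lemma Ck_square_mixed_derivative:
  assumes "Ck_square (Suc (Suc k)) I F"
  obtains F1 F12 where
    "\<And>x y. \<lbrakk>x \<in> I; y \<in> I\<rbrakk> \<Longrightarrow> ((\<lambda>s. F s y) has_real_derivative F1 x y) (at x within I)"
    "\<And>x y. \<lbrakk>x \<in> I; y \<in> I\<rbrakk> \<Longrightarrow> ((\<lambda>s. F1 x s) has_real_derivative F12 x y) (at y within I)"
    "Ck_square k I F12"
proof -
  from assms obtain F1 where
    1: "\<forall>x\<in>I. \<forall>y\<in>I. ((\<lambda>s. F s y) has_real_derivative F1 x y) (at x within I)"
    and C: "Ck_square (Suc k) I F1"
    unfolding Ck_square.simps(2)[of "Suc k"] by blast
  from C obtain F12 where
    2: "\<forall>x\<in>I. \<forall>y\<in>I. ((\<lambda>s. F1 x s) has_real_derivative F12 x y) (at y within I)"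
    and "Ck_square k I F12"
    unfolding Ck_square.simps(2)[of k] by blast
  with 1 2 that show ?thesis by blast
qed

lemma continuous_on_square_at:
  fixes G :: "real \<Rightarrow> real \<Rightarrow> real"
  assumes "continuous_on (I \<times> I) (\<lambda>(x, y). G x y)" "x \<in> I" "e > 0"
  obtains d where "d > 0"
    "\<And>s t. \<lbrakk>s \<in> I; t \<in> I; \<bar>s - x\<bar> < d; \<bar>t - x\<bar> < d\<rbrakk> \<Longrightarrow> \<bar>G s t - G x x\<bar> < e"
proof -
  obtain d where "d > 0" and
    d: "\<And>p. \<lbrakk>p \<in> I \<times> I; dist p (x, x) < d\<rbrakk> \<Longrightarrow> dist (case p of (s, t) \<Rightarrow> G s t) (G x x) < e"
    using assms unfolding continuous_on_iff by fastforce
  have "\<bar>G s t - G x x\<bar> < e" if "s \<in> I" "t \<in> I" "\<bar>s - x\<bar> < d / 2" "\<bar>t - x\<bar> < d / 2" for s t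
  proof -
    have "dist (s, t) (x, x) \<le> \<bar>s - x\<bar> + \<bar>t - x\<bar>"
      using sqrt_sum_squares_le_sum_abs[of "s - x" "t - x"]
      by (simp add: dist_Pair_Pair dist_real_def)
    then show ?thesis using d[of "(s, t)"] that by (simp add: dist_real_def)
  qed
  with that[of "d / 2"] \<open>d > 0\<close> show ?thesis by simp
qed

section \<open>Differentiable feature maps\<close>

context rkhs
begin

text \<open>
  A feature map \<open>\<Phi>\<close> whose Gram kernel \<open>G\<close> is of class \<open>C\<^sup>2\<close> is weakly differentiable, and the Gram kernel of its
  derivative is the mixed derivative of \<open>G\<close>.  The inner product of two difference quotients of \<open>\<Phi>\<close> at \<open>x\<close> is
  a value of the mixed derivative near \<open>(x, x)\<close>, so these quotients form a Cauchy family in norm; the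
  limit functional is represented by an element of \<open>H\<close>.
\<close>

lemma feature_derivative:
  fixes \<Phi> :: "real \<Rightarrow> real \<Rightarrow> real"
  assumes ab: "a < b"
    and mem: "\<And>x. x \<in> {a..b} \<Longrightarrow> \<Phi> x \<in> H"
    and gram: "\<And>x y. \<lbrakk>x \<in> {a..b}; y \<in> {a..b}\<rbrakk> \<Longrightarrow> ip (\<Phi> x) (\<Phi> y) = G x y"
    and smooth: "Ck_square (Suc (Suc k)) {a..b} G"
  obtains \<Psi> G' where
    "\<And>x. x \<in> {a..b} \<Longrightarrow> \<Psi> x \<in> H"
    "\<And>f x. \<lbrakk>f \<in> H; x \<in> {a..b}\<rbrakk> \<Longrightarrow>
       ((\<lambda>s. ip f (\<Phi> s)) has_real_derivative ip f (\<Psi> x)) (at x within {a..b})"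
    "\<And>x y. \<lbrakk>x \<in> {a..b}; y \<in> {a..b}\<rbrakk> \<Longrightarrow> ip (\<Psi> x) (\<Psi> y) = G' x y"
    "Ck_square k {a..b} G'"
proof -
  let ?I = "{a..b}"
  obtain G1 G12 where
    d1: "\<And>x y. \<lbrakk>x \<in> ?I; y \<in> ?I\<rbrakk> \<Longrightarrow> ((\<lambda>s. G s y) has_real_derivative G1 x y) (at x within ?I)"
    and d12: "\<And>x y. \<lbrakk>x \<in> ?I; y \<in> ?I\<rbrakk> \<Longrightarrow> ((\<lambda>s. G1 x s) has_real_derivative G12 x y) (at y within ?I)"
    and smooth12: "Ck_square k ?I G12"
    using Ck_square_mixed_derivative[OF smooth] by metis
  have sym: "G x y = G y x" if "x \<in> ?I" "y \<in> ?I" for x y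
    using gram ip_commute mem that by metis
  have "\<exists>r\<in>H. \<forall>f\<in>H. ((\<lambda>s. ip f (\<Phi> s)) has_real_derivative ip f r) (at x within ?I)"
    if x: "x \<in> ?I" for x
  proof -
    let ?F = "at x within ?I"
    have nontriv: "?F \<noteq> bot" using at_within_Icc_neq_bot[OF ab x] .
    define q where "q s = (\<lambda>y. (1 / (s - x)) * (\<Phi> s y - \<Phi> x y))" for s
    have q: "q s \<in> H" if "s \<in> ?I" for s
      unfolding q_def by (intro scale_mem diff_mem mem that x)
    have ip_q: "ip f (q s) = (ip f (\<Phi> s) - ip f (\<Phi> x)) / (s - x)" if "s \<in> ?I" "f \<in> H" for s f
      unfolding q_def using mem[OF x] mem[OF that(1)] that(2)
      by (simp only: ip_scale_right diff_mem ip_diff_right) simp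
    \<comment> \<open>Two applications of the mean value theorem, one in each variable of \<open>G\<close>.\<close>
    have gram_q: "\<exists>\<xi>\<in>?I. \<exists>\<eta>\<in>?I. \<bar>\<xi> - x\<bar> \<le> \<bar>s - x\<bar> \<and> \<bar>\<eta> - x\<bar> \<le> \<bar>t - x\<bar> \<and> ip (q s) (q t) = G12 \<xi> \<eta>"
      if s: "s \<in> ?I - {x}" and t: "t \<in> ?I - {x}" for s t
    proof -
      have s': "s \<in> ?I" and t': "t \<in> ?I" using s t by auto
      have "((\<lambda>u. G u t - G u x) has_real_derivative G1 u t - G1 u x) (at u within ?I)" if "u \<in> ?I" for u
        using d1[OF that t'] d1[OF that x] by (rule DERIV_diff)
      then obtain \<xi> where \<xi>: "\<xi> \<in> ?I" "\<bar>\<xi> - x\<bar> \<le> \<bar>s - x\<bar>"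
        "(G s t - G s x) - (G x t - G x x) = (G1 \<xi> t - G1 \<xi> x) * (s - x)"
        by (rule mean_value_Icc[OF _ x s']) auto
      obtain \<eta> where \<eta>: "\<eta> \<in> ?I" "\<bar>\<eta> - x\<bar> \<le> \<bar>t - x\<bar>" "G1 \<xi> t - G1 \<xi> x = G12 \<xi> \<eta> * (t - x)"
        by (rule mean_value_Icc[OF d12[OF \<xi>(1)] x t']) auto
      have "ip (q s) (q t) = (ip (q s) (\<Phi> t) - ip (q s) (\<Phi> x)) / (t - x)"
        using ip_q[OF t' q[OF s']] .
      also have "\<dots> = (ip (\<Phi> t) (q s) - ip (\<Phi> x) (q s)) / (t - x)"
        using ip_commute[OF q[OF s']] mem[OF x] mem[OF t'] by simp
      also have "\<dots> = ((G t s - G t x) / (s - x) - (G x s - G x x) / (s - x)) / (t - x)"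
        by (simp only: ip_q[OF s' mem[OF x]] ip_q[OF s' mem[OF t']] gram[OF t' s'] gram[OF t' x]
            gram[OF x s'] gram[OF x x])
      also have "\<dots> = ((G s t - G s x) - (G x t - G x x)) / ((s - x) * (t - x))"
        using sym[OF s' t'] sym[OF x t'] sym[OF x s'] by (simp add: diff_divide_distrib)
      also have "\<dots> = G12 \<xi> \<eta>" using \<xi>(3) \<eta>(3) s t by simp
      finally show ?thesis using \<xi> \<eta> by blast
    qed
    have near: "\<exists>d>0. \<forall>s\<in>?I - {x}. \<forall>t\<in>?I - {x}. \<bar>s - x\<bar> < d \<longrightarrow> \<bar>t - x\<bar> < d \<longrightarrow>
        \<bar>ip (q s) (q t) - G12 x x\<bar> < e" if "e > 0" for e
    proof -
      obtain d where "d > 0" and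
        d: "\<And>s t. \<lbrakk>s \<in> ?I; t \<in> ?I; \<bar>s - x\<bar> < d; \<bar>t - x\<bar> < d\<rbrakk> \<Longrightarrow> \<bar>G12 s t - G12 x x\<bar> < e"
        using continuous_on_square_at[OF Ck_square_imp_continuous[OF smooth12] x \<open>e > 0\<close>] by metis
      have "\<bar>ip (q s) (q t) - G12 x x\<bar> < e"
        if st: "s \<in> ?I - {x}" "t \<in> ?I - {x}" "\<bar>s - x\<bar> < d" "\<bar>t - x\<bar> < d" for s t
      proof -
        obtain \<xi> \<eta> where "\<xi> \<in> ?I" "\<eta> \<in> ?I" "\<bar>\<xi> - x\<bar> \<le> \<bar>s - x\<bar>" "\<bar>\<eta> - x\<bar> \<le> \<bar>t - x\<bar>"
          and eq: "ip (q s) (q t) = G12 \<xi> \<eta>"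
          using gram_q[OF st(1,2)] by blast
        then show ?thesis using d[of \<xi> \<eta>] st(3,4) by simp
      qed
      with \<open>d > 0\<close> show ?thesis by blast
    qed
    have "\<exists>l. ((\<lambda>s. ip f (q s)) \<longlongrightarrow> l) ?F" if f: "f \<in> H" for f
    proof (rule tendsto_of_cauchy_within[OF nontriv])
      fix e :: real
      assume "e > 0"
      \<comment> \<open>\<open>e'\<close> is chosen so that \<open>\<parallel>f\<parallel> * sqrt (4 * e') < e\<close>.\<close>
      define N where "N = sqrt (ip f f)"
      have N: "0 \<le> N" using ip_nonneg[OF f] by (simp add: N_def)
      define e' where "e' = (e / (N + 1))\<^sup>2 / 4"
      have "e' > 0" using \<open>e > 0\<close> N by (simp add: e'_def)
      then obtain d where "d > 0" and d: "\<forall>s\<in>?I - {x}. \<forall>t\<in>?I - {x}. \<bar>s - x\<bar> < d \<longrightarrow> \<bar>t - x\<bar> < d \<longrightarrow>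
        \<bar>ip (q s) (q t) - G12 x x\<bar> < e'" using near by blast
      have "\<bar>ip f (q s) - ip f (q t)\<bar> < e"
        if st: "s \<in> ?I - {x}" "t \<in> ?I - {x}" "\<bar>s - x\<bar> < d" "\<bar>t - x\<bar> < d" for s t
      proof -
        have qs: "q s \<in> H" and qt: "q t \<in> H" using st q by auto
        have "ip (\<lambda>y. q s y - q t y) (\<lambda>y. q s y - q t y) \<le> 4 * e'"
          using d[rule_format, of s s] d[rule_format, of s t] d[rule_format, of t t] st
          by (simp add: ip_diff_self qs qt abs_less_iff)
        then have "sqrt (ip (\<lambda>y. q s y - q t y) (\<lambda>y. q s y - q t y)) \<le> sqrt (4 * e')"
          by (rule real_sqrt_le_mono)
        also have "sqrt (4 * e') = e / (N + 1)"
          using N \<open>e > 0\<close> by (simp add: e'_def)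
        finally have *: "sqrt (ip (\<lambda>y. q s y - q t y) (\<lambda>y. q s y - q t y)) \<le> e / (N + 1)" .
        have "\<bar>ip f (q s) - ip f (q t)\<bar> = \<bar>ip f (\<lambda>y. q s y - q t y)\<bar>"
          by (simp add: ip_diff_right qs qt f)
        also have "\<dots> \<le> N * sqrt (ip (\<lambda>y. q s y - q t y) (\<lambda>y. q s y - q t y))"
          unfolding N_def by (intro cauchy_schwarz f diff_mem qs qt)
        also have "\<dots> \<le> N * (e / (N + 1))" using * N by (rule mult_left_mono)
        also have "\<dots> < e" using N \<open>e > 0\<close> by (simp add: field_simps)
        finally show ?thesis .
      qed
      with \<open>d > 0\<close> show "\<exists>d>0. \<forall>s\<in>?I - {x}. \<forall>t\<in>?I - {x}. \<bar>s - x\<bar> < d \<longrightarrow> \<bar>t - x\<bar> < d \<longrightarrow>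
        \<bar>ip f (q s) - ip f (q t)\<bar> < e" by blast
    qed blast
    then obtain L where L: "\<And>f. f \<in> H \<Longrightarrow> ((\<lambda>s. ip f (q s)) \<longlongrightarrow> L f) ?F" by metis
    have in_I: "\<forall>\<^sub>F s in ?F. s \<in> ?I - {x}" by (auto simp: eventually_at intro: exI[of _ 1])
    obtain r where "r \<in> H" and r: "\<And>f. f \<in> H \<Longrightarrow> L f = ip r f"
    proof (rule riesz_representation[of L])
      fix f g
      assume f: "f \<in> H" and g: "g \<in> H"
      have "((\<lambda>s. ip f (q s) + ip g (q s)) \<longlongrightarrow> L f + L g) ?F"
        by (intro tendsto_add L f g)
      moreover have "\<forall>\<^sub>F s in ?F. ip f (q s) + ip g (q s) = ip (\<lambda>x. f x + g x) (q s)"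
        using in_I by eventually_elim (simp add: ip_add f g q)
      ultimately have "((\<lambda>s. ip (\<lambda>x. f x + g x) (q s)) \<longlongrightarrow> L f + L g) ?F"
        by (rule Lim_transform_eventually)
      with L[OF add_mem[OF f g]] show "L (\<lambda>x. f x + g x) = L f + L g"
        using tendsto_unique[OF nontriv] by blast
    next
      fix c f
      assume f: "f \<in> H"
      have "((\<lambda>s. c * ip f (q s)) \<longlongrightarrow> c * L f) ?F"
        by (intro tendsto_mult_left L f)
      moreover have "\<forall>\<^sub>F s in ?F. c * ip f (q s) = ip (\<lambda>x. c * f x) (q s)"
        using in_I by eventually_elim (simp add: ip_scale f q)
      ultimately have "((\<lambda>s. ip (\<lambda>x. c * f x) (q s)) \<longlongrightarrow> c * L f) ?F"
        by (rule Lim_transform_eventually)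
      with L[OF scale_mem[OF f]] show "L (\<lambda>x. c * f x) = c * L f"
        using tendsto_unique[OF nontriv] by blast
    next
      fix f
      assume f: "f \<in> H"
      obtain d where "d > 0" and d: "\<forall>s\<in>?I - {x}. \<forall>t\<in>?I - {x}. \<bar>s - x\<bar> < d \<longrightarrow> \<bar>t - x\<bar> < d \<longrightarrow>
        \<bar>ip (q s) (q t) - G12 x x\<bar> < 1" using near[of 1] by auto
      have "\<forall>\<^sub>F s in ?F. s \<in> ?I - {x} \<and> \<bar>s - x\<bar> < d"
        using \<open>d > 0\<close> by (auto simp: eventually_at dist_real_def)
      then have "\<forall>\<^sub>F s in ?F. \<bar>ip f (q s)\<bar> \<le> sqrt (G12 x x + 1) * sqrt (ip f f)"
      proof eventually_elim
        case (elim s)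
        then have "sqrt (ip (q s) (q s)) \<le> sqrt (G12 x x + 1)"
          using d by (intro real_sqrt_le_mono) (force simp: abs_less_iff)
        then have "sqrt (ip f f) * sqrt (ip (q s) (q s)) \<le> sqrt (ip f f) * sqrt (G12 x x + 1)"
          using ip_nonneg[OF f] by (intro mult_left_mono) auto
        then show ?case using cauchy_schwarz[OF f q[of s]] elim by (simp add: mult.commute)
      qed
      then show "\<bar>L f\<bar> \<le> sqrt (G12 x x + 1) * sqrt (ip f f)"
        using tendsto_upperbound[OF tendsto_rabs[OF L[OF f]] _ nontriv] by blast
    qed blast
    have "((\<lambda>s. ip f (\<Phi> s)) has_real_derivative ip f r) ?F" if f: "f \<in> H" for f
    proof -
      have "\<forall>\<^sub>F s in ?F. ip f (q s) = (ip f (\<Phi> s) - ip f (\<Phi> x)) / (s - x)"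
        using in_I by eventually_elim (simp add: ip_q f)
      with L[OF f] have "((\<lambda>s. (ip f (\<Phi> s) - ip f (\<Phi> x)) / (s - x)) \<longlongrightarrow> L f) ?F"
        by (rule Lim_transform_eventually)
      then show ?thesis
        using r[OF f] ip_commute[OF f \<open>r \<in> H\<close>] by (simp add: has_field_derivative_iff)
    qed
    with \<open>r \<in> H\<close> show ?thesis by blast
  qed
  then obtain \<Psi> where \<Psi>: "\<And>x. x \<in> ?I \<Longrightarrow> \<Psi> x \<in> H"
    and deriv: "\<And>f x. \<lbrakk>f \<in> H; x \<in> ?I\<rbrakk> \<Longrightarrow>
       ((\<lambda>s. ip f (\<Phi> s)) has_real_derivative ip f (\<Psi> x)) (at x within ?I)"
    by metis
  have mixed: "ip (\<Psi> x) (\<Phi> y) = G1 x y" if "x \<in> ?I" "y \<in> ?I" for x y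
  proof -
    have "ip (\<Phi> y) (\<Psi> x) = G1 x y"
      by (rule real_derivative_unique_Icc[OF ab that(1) deriv[OF mem[OF that(2)] that(1)] d1[OF that]])
        (use that gram ip_commute mem in metis)
    then show ?thesis using ip_commute \<Psi> mem that by metis
  qed
  have "ip (\<Psi> x) (\<Psi> y) = G12 x y" if "x \<in> ?I" "y \<in> ?I" for x y
    by (rule real_derivative_unique_Icc[OF ab that(2) deriv[OF \<Psi>[OF that(1)] that(2)] d12[OF that]])
      (use that mixed in auto)
  with \<Psi> deriv smooth12 that show ?thesis by blast
qed

lemma feature_continuous:
  fixes \<Phi> :: "real \<Rightarrow> real \<Rightarrow> real"
  assumes mem: "\<And>x. x \<in> I \<Longrightarrow> \<Phi> x \<in> H"
    and gram: "\<And>x y. \<lbrakk>x \<in> I; y \<in> I\<rbrakk> \<Longrightarrow> ip (\<Phi> x) (\<Phi> y) = G x y"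
    and cont: "continuous_on (I \<times> I) (\<lambda>(x, y). G x y)"
    and f: "f \<in> H"
  shows "continuous_on I (\<lambda>x. ip f (\<Phi> x))"
  unfolding continuous_on_def
proof
  fix x
  assume x: "x \<in> I"
  have "continuous_on I (\<lambda>s. G s s)" "continuous_on I (\<lambda>s. G s x)"
    using continuous_on_compose2[OF cont, of I "\<lambda>s. (s, s)", OF continuous_on_Pair]
      continuous_on_compose2[OF cont, of I "\<lambda>s. (s, x)", OF continuous_on_Pair] x
    by (auto simp: continuous_on_id continuous_on_const)
  then have "continuous_on I (\<lambda>s. sqrt (ip f f) * sqrt (G s s - 2 * G s x + G x x))"
    by (intro continuous_intros)
  then have lim: "((\<lambda>s. sqrt (ip f f) * sqrt (G s s - 2 * G s x + G x x)) \<longlongrightarrow> 0) (at x within I)"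
    using x unfolding continuous_on_def by fastforce
  have "\<forall>\<^sub>F s in at x within I. norm (ip f (\<Phi> s) - ip f (\<Phi> x))
      \<le> sqrt (ip f f) * sqrt (G s s - 2 * G s x + G x x)"
    unfolding eventually_at
  proof (intro exI[of _ 1] conjI ballI impI)
    fix s
    assume s: "s \<in> I"
    then show "norm (ip f (\<Phi> s) - ip f (\<Phi> x)) \<le> sqrt (ip f f) * sqrt (G s s - 2 * G s x + G x x)"
      using cauchy_schwarz[OF f diff_mem[OF mem mem, of s x]] x
      by (simp add: ip_diff_right ip_diff_self mem f gram)
  qed simp
  then have "((\<lambda>s. ip f (\<Phi> s) - ip f (\<Phi> x)) \<longlongrightarrow> 0) (at x within I)"
    using lim by (rule Lim_null_comparison)
  then show "((\<lambda>s. ip f (\<Phi> s)) \<longlongrightarrow> ip f (\<Phi> x)) (at x within I)"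
    by (rule LIM_zero_cancel)
qed

lemma feature_bounded:
  fixes \<Phi> :: "real \<Rightarrow> real \<Rightarrow> real"
  assumes mem: "\<And>x. x \<in> I \<Longrightarrow> \<Phi> x \<in> H"
    and gram: "\<And>x y. \<lbrakk>x \<in> I; y \<in> I\<rbrakk> \<Longrightarrow> ip (\<Phi> x) (\<Phi> y) = G x y"
    and cont: "continuous_on (I \<times> I) (\<lambda>(x, y). G x y)"
    and compact: "compact I"
  obtains C where "0 \<le> C" "\<And>f x. \<lbrakk>f \<in> H; x \<in> I\<rbrakk> \<Longrightarrow> \<bar>ip f (\<Phi> x)\<bar> \<le> C * sqrt (ip f f)"
proof -
  have "continuous_on I (\<lambda>s. G s s)"
    using continuous_on_compose2[OF cont, of I "\<lambda>s. (s, s)", OF continuous_on_Pair]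
    by (auto simp: continuous_on_id)
  then have "bounded ((\<lambda>s. G s s) ` I)"
    using compact compact_continuous_image compact_imp_bounded by blast
  then obtain B where B: "\<And>s. s \<in> I \<Longrightarrow> \<bar>G s s\<bar> \<le> B" by (auto simp: bounded_iff)
  have "\<bar>ip f (\<Phi> x)\<bar> \<le> sqrt \<bar>B\<bar> * sqrt (ip f f)" if "f \<in> H" "x \<in> I" for f x
  proof -
    have "sqrt (ip (\<Phi> x) (\<Phi> x)) \<le> sqrt \<bar>B\<bar>"
      using B[OF that(2)] gram[OF that(2,2)] by (intro real_sqrt_le_mono) simp
    then have "sqrt (ip f f) * sqrt (ip (\<Phi> x) (\<Phi> x)) \<le> sqrt (ip f f) * sqrt \<bar>B\<bar>"
      using ip_nonneg[OF that(1)] by (intro mult_left_mono) auto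
    then show ?thesis using cauchy_schwarz[OF that(1) mem[OF that(2)]] by (simp add: mult.commute)
  qed
  with that[of "sqrt \<bar>B\<bar>"] show ?thesis by simp
qed

end

section \<open>First and second derivatives at the grid points\<close>

text \<open>The functions \<open>g1\<close> and \<open>g2\<close> are the first and second derivative of \<open>g\<close> on \<open>I\<close>, taken within \<open>I\<close>.\<close>

definition has_two_derivatives ::
  "real set \<Rightarrow> (real \<Rightarrow> real) \<Rightarrow> (real \<Rightarrow> real) \<Rightarrow> (real \<Rightarrow> real) \<Rightarrow> bool" where
  "has_two_derivatives I g g1 g2 \<longleftrightarrow> (\<forall>x\<in>I.
     (g has_real_derivative g1 x) (at x within I) \<and> (g1 has_real_derivative g2 x) (at x within I))"

lemma has_two_derivatives_add:
  "\<lbrakk>has_two_derivatives I g g1 g2; has_two_derivatives I h h1 h2\<rbrakk> \<Longrightarrow>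
    has_two_derivatives I (\<lambda>x. g x + h x) (\<lambda>x. g1 x + h1 x) (\<lambda>x. g2 x + h2 x)"
  by (simp add: has_two_derivatives_def DERIV_add)

lemma deriv_on_Icc:
  assumes "a < b" "x \<in> {a..b}" "(g has_real_derivative g') (at x within {a..b})"
  shows "deriv_on {a..b} g x = g'"
  unfolding deriv_on_def using assms
  by (intro vector_derivative_within at_within_Icc_neq_bot)
    (simp_all add: has_real_derivative_iff_has_vector_derivative)

lemma deriv_on_cong:
  assumes "x \<in> I" "\<And>s. s \<in> I \<Longrightarrow> g s = h s"
  shows "deriv_on I g x = deriv_on I h x"
proof -
  have "(g has_vector_derivative D) (at x within I) \<longleftrightarrow> (h has_vector_derivative D) (at x within I)" for D
    using has_vector_derivative_transform[OF assms(1), of g h D]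
      has_vector_derivative_transform[OF assms(1), of h g D] assms(2) by auto
  then show ?thesis by (simp add: deriv_on_def vector_derivative_def)
qed

lemma xg_mem: "\<lbrakk>valid_observation S; n \<in> {1..nx S}\<rbrakk> \<Longrightarrow> xg S n \<in> \<Omega> S"
proof -
  assume S: "valid_observation S" and n: "n \<in> {1..nx S}"
  then have v: "0 < vol S" "0 < nx S" by (auto simp: valid_observation_def vol_def)
  then have "real n * vol S \<le> real (nx S) * vol S" using n by (intro mult_right_mono) auto
  then have "real n * dx S \<le> vol S" using v by (simp add: dx_def field_simps)
  moreover have "0 \<le> real n * dx S" using v by (simp add: dx_def)
  ultimately show ?thesis by (simp add: xg_def \<Omega>_def vol_def)
qed

lemma prob_density_dens:
  "\<lbrakk>valid_observation S; l \<in> {1..nt S}\<rbrakk> \<Longrightarrow> prob_density_on (\<Omega> S) (dens S (tg S l))"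
proof -
  assume S: "valid_observation S" and l: "l \<in> {1..nt S}"
  then have v: "0 < horizon S" "0 < nt S" by (auto simp: valid_observation_def)
  then have "real l * horizon S \<le> real (nt S) * horizon S" using l by (intro mult_right_mono) auto
  then have "tg S l \<in> {0..horizon S}" using v by (simp add: tg_def dt_def field_simps)
  then show ?thesis using S by (simp add: valid_observation_def)
qed

lemma D_op_has_two_derivatives:
  assumes S: "valid_observation S" and n: "n \<in> {1..nx S}"
    and g: "has_two_derivatives (\<Omega> S) g g1 g2"
  shows "D_op S l n g = dx_plus S l n * g1 (xg S n) + dens S (tg S l) (xg S n) * g2 (xg S n)"
proof -
  have ab: "left_end S < right_end S" using S by (simp add: valid_observation_def)
  have x: "xg S n \<in> \<Omega> S" using xg_mem[OF S n] .
  have 1: "deriv_on (\<Omega> S) g s = g1 s" "deriv_on (\<Omega> S) g1 s = g2 s" if "s \<in> \<Omega> S" for s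
    using g that ab by (auto simp: has_two_derivatives_def \<Omega>_def intro!: deriv_on_Icc)
  have "deriv_on (\<Omega> S) (deriv_on (\<Omega> S) g) (xg S n) = deriv_on (\<Omega> S) g1 (xg S n)"
    by (rule deriv_on_cong[OF x]) (rule 1)
  then show ?thesis by (simp add: D_op_def 1 x)
qed

lemma D_op_cong:
  assumes S: "valid_observation S" and n: "n \<in> {1..nx S}"
    and eq: "\<And>s. s \<in> \<Omega> S \<Longrightarrow> g s = h s"
  shows "D_op S l n g = D_op S l n h"
proof -
  have 1: "deriv_on (\<Omega> S) g s = deriv_on (\<Omega> S) h s" if "s \<in> \<Omega> S" for s
    by (rule deriv_on_cong[OF that eq])
  have "deriv_on (\<Omega> S) (deriv_on (\<Omega> S) g) (xg S n) = deriv_on (\<Omega> S) (deriv_on (\<Omega> S) h) (xg S n)"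
    by (rule deriv_on_cong[OF xg_mem[OF S n] 1])
  then show ?thesis by (simp add: D_op_def 1 xg_mem[OF S n])
qed

lemma D_op_add:
  assumes "valid_observation S" "n \<in> {1..nx S}"
    and "has_two_derivatives (\<Omega> S) g g1 g2" "has_two_derivatives (\<Omega> S) h h1 h2"
  shows "D_op S l n (\<lambda>x. g x + h x) = D_op S l n g + D_op S l n h"
  using assms has_two_derivatives_add[OF assms(3,4)]
  by (simp add: D_op_has_two_derivatives algebra_simps)

lemma differences_eq:
  assumes "valid_observation S"
  shows "{x - z | x z. x \<in> \<Omega> S \<and> z \<in> \<Omega> S} = {left_end S - right_end S..right_end S - left_end S}"
    (is "?A = ?J")
proof
  show "?A \<subseteq> ?J" by (auto simp: \<Omega>_def)
  have ab: "left_end S < right_end S" using assms by (simp add: valid_observation_def)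
  show "?J \<subseteq> ?A"
  proof
    fix u
    assume u: "u \<in> ?J"
    show "u \<in> ?A"
    proof (cases "0 \<le> u")
      case True
      have "u = (left_end S + u) - left_end S" by simp
      moreover have "left_end S + u \<in> \<Omega> S" "left_end S \<in> \<Omega> S" using u True ab by (auto simp: \<Omega>_def)
      ultimately show ?thesis by blast
    next
      case False
      have "u = (right_end S + u) - right_end S" by simp
      moreover have "right_end S + u \<in> \<Omega> S" "right_end S \<in> \<Omega> S" using u False ab by (auto simp: \<Omega>_def)
      ultimately show ?thesis by blast
    qed
  qed
qed

section \<open>Convolution with an integrable density\<close>

lemma convolution_integrable:
  fixes f r :: "real \<Rightarrow> real"
  assumes cont: "continuous_on {a - b..b - a} f" and r: "set_integrable lborel {a..b} r"
    and x: "x \<in> {a..b}"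
  shows "set_integrable lborel {a..b} (\<lambda>z. f (x - z) * r z)"
proof -
  have "bounded (f ` {a - b..b - a})"
    using cont compact_continuous_image compact_imp_bounded by blast
  then obtain B where B: "\<And>u. u \<in> {a - b..b - a} \<Longrightarrow> \<bar>f u\<bar> \<le> B"
    by (force simp: bounded_iff)
  have "continuous_on {a..b} (\<lambda>z. f (x - z))"
    using x by (intro continuous_on_compose2[OF cont] continuous_intros) auto
  then have "(\<lambda>z. indicator {a..b} z *\<^sub>R f (x - z)) \<in> borel_measurable borel"
    by (intro borel_measurable_continuous_on_indicator) auto
  moreover have "(\<lambda>z. indicator {a..b} z *\<^sub>R r z) \<in> borel_measurable borel"
    using r by (simp add: set_integrable_def borel_measurable_integrable)
  ultimately have "(\<lambda>z. (indicator {a..b} z *\<^sub>R f (x - z)) * (indicator {a..b} z *\<^sub>R r z))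
      \<in> borel_measurable borel"
    by (rule borel_measurable_times)
  moreover have "(\<lambda>z. (indicator {a..b} z *\<^sub>R f (x - z)) * (indicator {a..b} z *\<^sub>R r z))
      = (\<lambda>z. indicator {a..b} z *\<^sub>R (f (x - z) * r z))"
    by (auto simp: indicator_def)
  ultimately have meas: "set_borel_measurable lborel {a..b} (\<lambda>z. f (x - z) * r z)"
    by (simp add: set_borel_measurable_def)
  have "set_integrable lborel {a..b} (\<lambda>z. B * r z)" using r by simp
  then show ?thesis
  proof (rule set_integrable_bound[OF _ meas], intro AE_I2 impI)
    fix z
    assume "z \<in> {a..b}"
    then have "\<bar>f (x - z)\<bar> \<le> \<bar>B\<bar>" using B[of "x - z"] x by auto
    then show "norm (f (x - z) * r z) \<le> norm (B * r z)" by (simp add: abs_mult mult_right_mono)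
  qed
qed

lemma set_integral_abs_le:
  fixes g r :: "real \<Rightarrow> real"
  assumes g: "set_integrable lborel A g" and r: "set_integrable lborel A r"
    and le: "\<And>z. z \<in> A \<Longrightarrow> \<bar>g z\<bar> \<le> e * r z"
  shows "\<bar>LINT z:A|lborel. g z\<bar> \<le> e * (LINT z:A|lborel. r z)"
proof -
  have "(LINT z:A|lborel. g z) \<le> (LINT z:A|lborel. e * r z)"
    using le by (intro set_integral_mono g) (auto simp: r abs_le_iff)
  moreover have "(LINT z:A|lborel. - g z) \<le> (LINT z:A|lborel. e * r z)"
    using le g by (intro set_integral_mono) (auto simp: r abs_le_iff set_integrable_def[of _ _ g] set_integrable_def[of _ _ "\<lambda>z. - g z"])
  ultimately show ?thesis by (simp add: set_integral_uminus[OF g])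
qed

text \<open>
  Differentiation under a convolution integral.  The density is only integrable, but the difference
  quotients of \<open>f\<close> converge uniformly because \<open>f1\<close> is uniformly continuous on the compact interval
  of all differences.
\<close>

lemma convolution_derivative:
  fixes f r :: "real \<Rightarrow> real"
  assumes r: "prob_density_on {a..b} r"
    and deriv: "\<And>u. u \<in> {a - b..b - a} \<Longrightarrow> (f has_real_derivative f1 u) (at u within {a - b..b - a})"
    and cont: "continuous_on {a - b..b - a} f1"
    and x: "x \<in> {a..b}"
  shows "((\<lambda>x. LINT z:{a..b}|lborel. f (x - z) * r z) has_real_derivative
    (LINT z:{a..b}|lborel. f1 (x - z) * r z)) (at x within {a..b})"
proof -
  let ?J = "{a - b..b - a}"
  have rint: "set_integrable lborel {a..b} r" and rpos: "\<And>z. z \<in> {a..b} \<Longrightarrow> 0 \<le> r z"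
    and r1: "(LINT z:{a..b}|lborel. r z) = 1"
    using r by (auto simp: prob_density_on_def)
  have contf: "continuous_on ?J f" using deriv DERIV_continuous_on by blast
  have "\<exists>d>0. \<forall>s\<in>{a..b}. norm (s - x) < d \<longrightarrow>
      norm ((LINT z:{a..b}|lborel. f (s - z) * r z) - (LINT z:{a..b}|lborel. f (x - z) * r z)
        - (LINT z:{a..b}|lborel. f1 (x - z) * r z) * (s - x)) \<le> e * norm (s - x)"
    if "e > 0" for e
  proof -
    have "uniformly_continuous_on ?J f1" using cont by (intro compact_uniformly_continuous) auto
    then obtain d where "d > 0" and
      d: "\<And>u v. \<lbrakk>u \<in> ?J; v \<in> ?J; dist v u < d\<rbrakk> \<Longrightarrow> dist (f1 v) (f1 u) < e"
      using \<open>e > 0\<close> unfolding uniformly_continuous_on_def by metis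
    have "norm ((LINT z:{a..b}|lborel. f (s - z) * r z) - (LINT z:{a..b}|lborel. f (x - z) * r z)
        - (LINT z:{a..b}|lborel. f1 (x - z) * r z) * (s - x)) \<le> e * norm (s - x)"
      if s: "s \<in> {a..b}" and near: "norm (s - x) < d" for s
    proof -
      have i: "set_integrable lborel {a..b} (\<lambda>z. f (s - z) * r z)"
        "set_integrable lborel {a..b} (\<lambda>z. f (x - z) * r z)"
        "set_integrable lborel {a..b} (\<lambda>z. f1 (x - z) * r z)"
        using convolution_integrable contf cont rint s x by blast+
      then have i3: "set_integrable lborel {a..b} (\<lambda>z. f1 (x - z) * r z * (s - x))" by simp
      let ?g = "\<lambda>z. f (s - z) * r z - f (x - z) * r z - f1 (x - z) * r z * (s - x)"
      have "\<bar>?g z\<bar> \<le> (e * \<bar>s - x\<bar>) * r z" if z: "z \<in> {a..b}" for z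
      proof -
        have in_J: "x - z \<in> ?J" "s - z \<in> ?J" using x s z by auto
        obtain \<xi> where \<xi>: "\<xi> \<in> ?J" "\<bar>\<xi> - (x - z)\<bar> \<le> \<bar>(s - z) - (x - z)\<bar>"
          "f (s - z) - f (x - z) = f1 \<xi> * ((s - z) - (x - z))"
          by (rule mean_value_Icc[OF deriv in_J])
        have "\<bar>f1 \<xi> - f1 (x - z)\<bar> \<le> e"
          using d[OF in_J(1) \<xi>(1)] \<xi>(2) near by (simp add: dist_real_def)
        then have "\<bar>f1 \<xi> - f1 (x - z)\<bar> * (\<bar>s - x\<bar> * r z) \<le> e * (\<bar>s - x\<bar> * r z)"
          using rpos[OF z] by (intro mult_right_mono) auto
        moreover have "?g z = (f (s - z) - f (x - z) - f1 (x - z) * (s - x)) * r z"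
          by (simp add: algebra_simps)
        then have "?g z = (f1 \<xi> - f1 (x - z)) * (s - x) * r z"
          unfolding \<xi>(3) by (simp add: algebra_simps)
        ultimately show ?thesis using rpos[OF z] by (simp add: abs_mult mult.assoc)
      qed
      then have "\<bar>LINT z:{a..b}|lborel. ?g z\<bar> \<le> (e * \<bar>s - x\<bar>) * (LINT z:{a..b}|lborel. r z)"
        by (intro set_integral_abs_le rint set_integral_diff(1) i i3)
      then show ?thesis by (simp add: set_integral_diff i i3 r1)
    qed
    with \<open>d > 0\<close> show ?thesis by blast
  qed
  then show ?thesis
    unfolding has_field_derivative_def has_derivative_within_alt
    by (simp add: bounded_linear_mult_right)
qed

section \<open>Representers of derivatives and convolutions\<close>

context rkhs
begin

text \<open>
  Weak continuity together with a uniform bound of the functionals \<open>f \<mapsto> \<langle>f, \<Phi> x\<rangle>\<close>: what is needed to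
  integrate these functionals over \<open>x\<close>.
\<close>

definition regular_feature :: "real set \<Rightarrow> (real \<Rightarrow> real \<Rightarrow> real) \<Rightarrow> bool" where
  "regular_feature I \<Phi> \<longleftrightarrow> (\<forall>x\<in>I. \<Phi> x \<in> H) \<and> (\<forall>f\<in>H. continuous_on I (\<lambda>x. ip f (\<Phi> x))) \<and>
     (\<exists>C. \<forall>f\<in>H. \<forall>x\<in>I. \<bar>ip f (\<Phi> x)\<bar> \<le> C * sqrt (ip f f))"

lemma regular_featureI:
  fixes \<Phi> :: "real \<Rightarrow> real \<Rightarrow> real"
  assumes "\<And>x. x \<in> {a..b} \<Longrightarrow> \<Phi> x \<in> H"
    and "\<And>x y. \<lbrakk>x \<in> {a..b}; y \<in> {a..b}\<rbrakk> \<Longrightarrow> ip (\<Phi> x) (\<Phi> y) = G x y"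
    and "Ck_square k {a..b} G"
  shows "regular_feature {a..b} \<Phi>"
  unfolding regular_feature_def
  using feature_continuous[OF assms(1,2) Ck_square_imp_continuous[OF assms(3)]]
    feature_bounded[OF assms(1,2) Ck_square_imp_continuous[OF assms(3)]] assms(1)
  by (metis compact_Icc)

text \<open>
  Each application of \<open>feature_derivative\<close> uses up two derivatives of the Gram kernel, so a \<open>C\<^sup>4\<close> kernel
  gives two derivatives of the elements of \<open>H\<close>.
\<close>

lemma kernel_derivative_features:
  assumes ab: "a < b" and sym: "\<And>x y. K x y = K y x" and smooth: "Ck_square 4 {a..b} K"
  obtains \<Phi>1 \<Phi>2 where
    "regular_feature {a..b} K" "regular_feature {a..b} \<Phi>1" "regular_feature {a..b} \<Phi>2"
    "\<And>f. f \<in> H \<Longrightarrow> has_two_derivatives {a..b} f (\<lambda>s. ip f (\<Phi>1 s)) (\<lambda>s. ip f (\<Phi>2 s))"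
proof -
  have gram: "ip (K x) (K y) = K x y" for x y
    using reproducing[OF kernel_mem] .
  have four: "Ck_square (Suc (Suc 2)) {a..b} K" using smooth by (simp add: eval_nat_numeral)
  obtain \<Phi>1 G1 where \<Phi>1: "\<And>x. x \<in> {a..b} \<Longrightarrow> \<Phi>1 x \<in> H"
    "\<And>f x. \<lbrakk>f \<in> H; x \<in> {a..b}\<rbrakk> \<Longrightarrow>
       ((\<lambda>s. ip f (K s)) has_real_derivative ip f (\<Phi>1 x)) (at x within {a..b})"
    "\<And>x y. \<lbrakk>x \<in> {a..b}; y \<in> {a..b}\<rbrakk> \<Longrightarrow> ip (\<Phi>1 x) (\<Phi>1 y) = G1 x y"
    and G1: "Ck_square 2 {a..b} G1"
    using feature_derivative[OF ab kernel_mem gram four] by metis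
  have two: "Ck_square (Suc (Suc 0)) {a..b} G1" using G1 by (simp add: eval_nat_numeral)
  obtain \<Phi>2 G2 where \<Phi>2: "\<And>x. x \<in> {a..b} \<Longrightarrow> \<Phi>2 x \<in> H"
    "\<And>f x. \<lbrakk>f \<in> H; x \<in> {a..b}\<rbrakk> \<Longrightarrow>
       ((\<lambda>s. ip f (\<Phi>1 s)) has_real_derivative ip f (\<Phi>2 x)) (at x within {a..b})"
    "\<And>x y. \<lbrakk>x \<in> {a..b}; y \<in> {a..b}\<rbrakk> \<Longrightarrow> ip (\<Phi>2 x) (\<Phi>2 y) = G2 x y"
    and G2: "Ck_square 0 {a..b} G2"
    using feature_derivative[OF ab \<Phi>1(1,3) two] by metis
  show ?thesis
  proof (rule that)
    show "regular_feature {a..b} K" by (rule regular_featureI[OF kernel_mem gram smooth])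
    show "regular_feature {a..b} \<Phi>1" by (rule regular_featureI[OF \<Phi>1(1,3) G1])
    show "regular_feature {a..b} \<Phi>2" by (rule regular_featureI[OF \<Phi>2(1,3) G2])
    fix f
    assume f: "f \<in> H"
    have "(\<lambda>s. ip f (K s)) = f" using reproducing[OF f] by auto
    then show "has_two_derivatives {a..b} f (\<lambda>s. ip f (\<Phi>1 s)) (\<lambda>s. ip f (\<Phi>2 s))"
      using \<Phi>1(2)[OF f] \<Phi>2(2)[OF f] by (simp add: has_two_derivatives_def)
  qed
qed

text \<open>For \<open>x\<close> and \<open>z\<close> in \<open>{a..b}\<close>, the difference \<open>x - z\<close> ranges over \<open>{a - b..b - a}\<close>.\<close>

lemma convolution_representer:
  assumes r: "prob_density_on {a..b} r" and \<Phi>: "regular_feature {a - b..b - a} \<Phi>" and x: "x \<in> {a..b}"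
  obtains m where "m \<in> H"
    "\<And>f. f \<in> H \<Longrightarrow> (LINT z:{a..b}|lborel. ip f (\<Phi> (x - z)) * r z) = ip m f"
proof -
  have rint: "set_integrable lborel {a..b} r" and rpos: "\<And>z. z \<in> {a..b} \<Longrightarrow> 0 \<le> r z"
    and r1: "(LINT z:{a..b}|lborel. r z) = 1"
    using r by (auto simp: prob_density_on_def)
  have in_J: "x - z \<in> {a - b..b - a}" if "z \<in> {a..b}" for z using x that by auto
  have mem: "\<Phi> (x - z) \<in> H" if "z \<in> {a..b}" for z
    using \<Phi> in_J[OF that] by (simp add: regular_feature_def)
  obtain C where C: "\<And>f u. \<lbrakk>f \<in> H; u \<in> {a - b..b - a}\<rbrakk> \<Longrightarrow> \<bar>ip f (\<Phi> u)\<bar> \<le> C * sqrt (ip f f)"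
    using \<Phi> unfolding regular_feature_def by blast
  have int: "set_integrable lborel {a..b} (\<lambda>z. ip f (\<Phi> (x - z)) * r z)" if "f \<in> H" for f
    using \<Phi> that
    by (intro convolution_integrable[where f = "\<lambda>u. ip f (\<Phi> u)"] rint x)
      (auto simp: regular_feature_def)
  show ?thesis
  proof (rule riesz_representation[of "\<lambda>f. LINT z:{a..b}|lborel. ip f (\<Phi> (x - z)) * r z"])
    fix f g
    assume f: "f \<in> H" and g: "g \<in> H"
    have "(LINT z:{a..b}|lborel. ip (\<lambda>y. f y + g y) (\<Phi> (x - z)) * r z)
        = (LINT z:{a..b}|lborel. ip f (\<Phi> (x - z)) * r z + ip g (\<Phi> (x - z)) * r z)"
      by (rule set_lebesgue_integral_cong) (auto simp: ip_add f g mem distrib_right)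
    then show "(LINT z:{a..b}|lborel. ip (\<lambda>y. f y + g y) (\<Phi> (x - z)) * r z)
        = (LINT z:{a..b}|lborel. ip f (\<Phi> (x - z)) * r z) + (LINT z:{a..b}|lborel. ip g (\<Phi> (x - z)) * r z)"
      by (simp add: int f g)
  next
    fix c f
    assume f: "f \<in> H"
    have "(LINT z:{a..b}|lborel. ip (\<lambda>y. c * f y) (\<Phi> (x - z)) * r z)
        = (LINT z:{a..b}|lborel. c * (ip f (\<Phi> (x - z)) * r z))"
      by (rule set_lebesgue_integral_cong) (auto simp: ip_scale f mem)
    then show "(LINT z:{a..b}|lborel. ip (\<lambda>y. c * f y) (\<Phi> (x - z)) * r z)
        = c * (LINT z:{a..b}|lborel. ip f (\<Phi> (x - z)) * r z)"
      by simp
  next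
    fix f
    assume f: "f \<in> H"
    have "\<bar>LINT z:{a..b}|lborel. ip f (\<Phi> (x - z)) * r z\<bar>
        \<le> (C * sqrt (ip f f)) * (LINT z:{a..b}|lborel. r z)"
    proof (rule set_integral_abs_le[OF int[OF f] rint])
      fix z
      assume z: "z \<in> {a..b}"
      show "\<bar>ip f (\<Phi> (x - z)) * r z\<bar> \<le> (C * sqrt (ip f f)) * r z"
        using mult_right_mono[OF C[OF f in_J[OF z]] rpos[OF z]] rpos[OF z] by (simp add: abs_mult)
    qed
    then show "\<bar>LINT z:{a..b}|lborel. ip f (\<Phi> (x - z)) * r z\<bar> \<le> C * sqrt (ip f f)"
      by (simp add: r1)
  qed (use that in blast)
qed

end

section \<open>Representers of the observation functionals\<close>

context rkhs
begin

lemma combination_representer: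
  assumes "p \<in> H" "q \<in> H"
  shows "(\<lambda>x. c * p x + d * q x) \<in> H"
    and "f \<in> H \<Longrightarrow> ip (\<lambda>x. c * p x + d * q x) f = c * ip p f + d * ip q f"
  using assms by (simp_all add: axpy_mem scale_mem ip_axpy_left ip_scale)

lemma mem_has_two_derivatives:
  assumes "valid_observation S" "\<And>x y. K x y = K y x" "Ck_square 4 (\<Omega> S) K" "f \<in> H"
  obtains f1 f2 where "has_two_derivatives (\<Omega> S) f f1 f2"
proof -
  have ab: "left_end S < right_end S" using assms(1) by (simp add: valid_observation_def)
  show ?thesis
    using kernel_derivative_features[OF ab assms(2) assms(3)[unfolded \<Omega>_def]] assms(4) that
    unfolding \<Omega>_def by metis
qed

lemma D_op_representer:
  assumes S: "valid_observation S" and sym: "\<And>x y. K x y = K y x"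
    and smooth: "Ck_square 4 (\<Omega> S) K" and n: "n \<in> {1..nx S}"
  obtains p where "p \<in> H" "\<And>f. f \<in> H \<Longrightarrow> D_op S l n f = ip p f"
proof -
  have ab: "left_end S < right_end S" using S by (simp add: valid_observation_def)
  obtain \<Phi>1 \<Phi>2 where reg: "regular_feature (\<Omega> S) \<Phi>1" "regular_feature (\<Omega> S) \<Phi>2"
    and two: "\<And>f. f \<in> H \<Longrightarrow> has_two_derivatives (\<Omega> S) f (\<lambda>s. ip f (\<Phi>1 s)) (\<lambda>s. ip f (\<Phi>2 s))"
    using kernel_derivative_features[OF ab sym smooth[unfolded \<Omega>_def]] unfolding \<Omega>_def by metis
  let ?x = "xg S n"
  have \<Phi>: "\<Phi>1 ?x \<in> H" "\<Phi>2 ?x \<in> H"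
    using reg xg_mem[OF S n] by (simp_all add: regular_feature_def)
  let ?p = "\<lambda>y. dx_plus S l n * \<Phi>1 ?x y + dens S (tg S l) ?x * \<Phi>2 ?x y"
  have "D_op S l n f = ip ?p f" if "f \<in> H" for f
    unfolding combination_representer(2)[OF \<Phi> that] D_op_has_two_derivatives[OF S n two[OF that]]
    using ip_commute \<Phi> that by simp
  with combination_representer(1)[OF \<Phi>] that show ?thesis by blast
qed

text \<open>
  The values and the first two derivatives of \<open>\<psi> * \<rho>\<close> at a point of \<open>\<Omega>\<close> are bounded functionals of \<open>\<psi>\<close>, with
  representers \<open>m\<close>, \<open>m1\<close>, \<open>m2\<close>.
\<close>

lemma conv_fun_representers:
  assumes S: "valid_observation S" and sym: "\<And>x y. K x y = K y x"
    and smooth: "Ck_square 4 {x - z | x z. x \<in> \<Omega> S \<and> z \<in> \<Omega> S} K"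
    and l: "l \<in> {1..nt S}"
  obtains m m1 m2 where
    "\<And>x. x \<in> \<Omega> S \<Longrightarrow> m x \<in> H" "\<And>x. x \<in> \<Omega> S \<Longrightarrow> m1 x \<in> H" "\<And>x. x \<in> \<Omega> S \<Longrightarrow> m2 x \<in> H"
    "\<And>f x. \<lbrakk>f \<in> H; x \<in> \<Omega> S\<rbrakk> \<Longrightarrow> conv_fun S l f x = ip (m x) f"
    "\<And>f. f \<in> H \<Longrightarrow> has_two_derivatives (\<Omega> S) (conv_fun S l f) (\<lambda>x. ip (m1 x) f) (\<lambda>x. ip (m2 x) f)"
proof -
  define a where "a = left_end S"
  define b where "b = right_end S"
  have \<Omega>: "\<Omega> S = {a..b}" by (simp add: \<Omega>_def a_def b_def)
  have ab: "a - b < b - a" using S by (simp add: valid_observation_def a_def b_def)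
  let ?J = "{a - b..b - a}" and ?r = "dens S (tg S l)"
  have r: "prob_density_on {a..b} ?r" using prob_density_dens[OF S l] by (simp add: \<Omega>)
  have smoothJ: "Ck_square 4 ?J K" using smooth differences_eq[OF S] by (simp add: a_def b_def)
  obtain \<Phi>1 \<Phi>2 where reg: "regular_feature ?J K" "regular_feature ?J \<Phi>1" "regular_feature ?J \<Phi>2"
    and two: "\<And>f. f \<in> H \<Longrightarrow> has_two_derivatives ?J f (\<lambda>s. ip f (\<Phi>1 s)) (\<lambda>s. ip f (\<Phi>2 s))"
    using kernel_derivative_features[OF ab sym smoothJ] by metis
  let ?C = "\<lambda>\<Phi> f x. LINT z:{a..b}|lborel. ip f (\<Phi> (x - z)) * ?r z"
  have "\<exists>m. \<forall>x\<in>{a..b}. m x \<in> H \<and> (\<forall>f\<in>H. ?C \<Phi> f x = ip (m x) f)"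
    if \<Phi>: "regular_feature ?J \<Phi>" for \<Phi>
  proof (rule bchoice, rule ballI)
    fix x
    assume x: "x \<in> {a..b}"
    obtain m where "m \<in> H" "\<And>f. f \<in> H \<Longrightarrow> ?C \<Phi> f x = ip m f"
      by (rule convolution_representer[OF r \<Phi> x]) (rule that)
    then show "\<exists>m. m \<in> H \<and> (\<forall>f\<in>H. ?C \<Phi> f x = ip m f)" by (intro exI[of _ m]) simp
  qed
  from this[OF reg(1)] this[OF reg(2)] this[OF reg(3)] obtain m m1 m2 where
    m: "\<forall>x\<in>{a..b}. m x \<in> H \<and> (\<forall>f\<in>H. ?C K f x = ip (m x) f)" and
    m1: "\<forall>x\<in>{a..b}. m1 x \<in> H \<and> (\<forall>f\<in>H. ?C \<Phi>1 f x = ip (m1 x) f)" and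
    m2: "\<forall>x\<in>{a..b}. m2 x \<in> H \<and> (\<forall>f\<in>H. ?C \<Phi>2 f x = ip (m2 x) f)"
    by blast
  have conv: "conv_fun S l f = ?C K f" if "f \<in> H" for f
    using reproducing[OF that] by (simp add: conv_fun_def \<Omega> fun_eq_iff)
  show ?thesis
  proof (rule that[of m m1 m2])
    fix f
    assume f: "f \<in> H"
    have fK: "(\<lambda>s. ip f (K s)) = f" using reproducing[OF f] by auto
    show "has_two_derivatives (\<Omega> S) (conv_fun S l f) (\<lambda>x. ip (m1 x) f) (\<lambda>x. ip (m2 x) f)"
      unfolding has_two_derivatives_def
    proof (intro ballI conjI)
      fix x
      assume "x \<in> \<Omega> S"
      then have x: "x \<in> {a..b}" by (simp add: \<Omega>)
      have "(?C K f has_real_derivative ?C \<Phi>1 f x) (at x within {a..b})"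
        using two[OF f] reg f x fK
        by (intro convolution_derivative[OF r]) (auto simp: has_two_derivatives_def regular_feature_def)
      then show "(conv_fun S l f has_real_derivative ip (m1 x) f) (at x within \<Omega> S)"
        using conv[OF f] m1 x f by (simp add: \<Omega>)
      have "(?C \<Phi>1 f has_real_derivative ?C \<Phi>2 f x) (at x within {a..b})"
        using two[OF f] reg f x
        by (intro convolution_derivative[OF r]) (auto simp: has_two_derivatives_def regular_feature_def)
      then have "((\<lambda>x. ip (m1 x) f) has_real_derivative ?C \<Phi>2 f x) (at x within {a..b})"
        by (rule has_field_derivative_transform_within[where d = 1]) (use m1 x f in auto)
      then show "((\<lambda>x. ip (m1 x) f) has_real_derivative ip (m2 x) f) (at x within \<Omega> S)"
        using m2 x f by (simp add: \<Omega>)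
    qed
  qed (use m m1 m2 conv in \<open>auto simp: \<Omega>\<close>)
qed

lemma D_op_conv_representer:
  assumes S: "valid_observation S" and sym: "\<And>x y. K x y = K y x"
    and smooth: "Ck_square 4 {x - z | x z. x \<in> \<Omega> S \<and> z \<in> \<Omega> S} K"
    and l: "l \<in> {1..nt S}" and n: "n \<in> {1..nx S}"
  obtains r where "r \<in> H" "\<And>f. f \<in> H \<Longrightarrow> D_op S l n (conv_fun S l f) = ip r f"
proof -
  obtain m1 m2 where m: "\<And>x. x \<in> \<Omega> S \<Longrightarrow> m1 x \<in> H" "\<And>x. x \<in> \<Omega> S \<Longrightarrow> m2 x \<in> H"
    and two: "\<And>f. f \<in> H \<Longrightarrow>
      has_two_derivatives (\<Omega> S) (conv_fun S l f) (\<lambda>x. ip (m1 x) f) (\<lambda>x. ip (m2 x) f)"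
    using conv_fun_representers[OF S sym smooth l] by metis
  let ?x = "xg S n"
  have mx: "m1 ?x \<in> H" "m2 ?x \<in> H" using m xg_mem[OF S n] by auto
  let ?r = "\<lambda>y. dx_plus S l n * m1 ?x y + dens S (tg S l) ?x * m2 ?x y"
  have "D_op S l n (conv_fun S l f) = ip ?r f" if "f \<in> H" for f
    unfolding combination_representer(2)[OF mx that] D_op_has_two_derivatives[OF S n two[OF that]] ..
  with combination_representer(1)[OF mx] that show ?thesis by blast
qed

text \<open>
  The representer \<open>q\<close> satisfies \<open>q x = \<langle>q, K x\<rangle>\<close>, so applying the second functional to the second argument of
  \<open>K\<close> yields \<open>q\<close> itself.
\<close>

lemma D_op_D_op_kernel:
  assumes p: "p \<in> H" "\<And>f. f \<in> H \<Longrightarrow> D_op S l n f = ip p f"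
    and q: "q \<in> H" "\<And>f. f \<in> H \<Longrightarrow> D_op S k m f = ip q f"
  shows "D_op S l n (\<lambda>x. D_op S k m (\<lambda>y. K x y)) = ip p q"
proof -
  have "(\<lambda>x. D_op S k m (\<lambda>y. K x y)) = q"
    using q(2)[OF kernel_mem] reproducing[OF q(1)] by simp
  then show ?thesis using p(2)[OF q(1)] by simp
qed

text \<open>
  The doubly convolved kernel is \<open>\<langle>m\<^sub>k y, m\<^sub>l x\<rangle>\<close>, where \<open>m\<^sub>l x\<close> represents \<open>\<psi> \<mapsto> (\<psi> * \<rho>\<^sub>l) x\<close>.
  The symmetry of the inner product therefore exchanges the two integrals.
\<close>

lemma D_op_D_op_conv_kernel:
  assumes S: "valid_observation S" and sym: "\<And>x y. K x y = K y x"
    and smooth: "Ck_square 4 {x - z | x z. x \<in> \<Omega> S \<and> z \<in> \<Omega> S} K"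
    and l: "l \<in> {1..nt S}" and k: "k \<in> {1..nt S}" and n: "n \<in> {1..nx S}" and m: "m \<in> {1..nx S}"
    and p: "p \<in> H" "\<And>f. f \<in> H \<Longrightarrow> D_op S l n (conv_fun S l f) = ip p f"
    and q: "q \<in> H" "\<And>f. f \<in> H \<Longrightarrow> D_op S k m (conv_fun S k f) = ip q f"
  shows "D_op S l n (\<lambda>x. D_op S k m (\<lambda>y. conv_ker2 S l k K x y)) = ip p q"
proof -
  obtain M where M: "\<And>x. x \<in> \<Omega> S \<Longrightarrow> M x \<in> H"
    "\<And>f x. \<lbrakk>f \<in> H; x \<in> \<Omega> S\<rbrakk> \<Longrightarrow> conv_fun S l f x = ip (M x) f"
    using conv_fun_representers[OF S sym smooth l] by metis
  obtain N where N: "\<And>x. x \<in> \<Omega> S \<Longrightarrow> N x \<in> H"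
    "\<And>f x. \<lbrakk>f \<in> H; x \<in> \<Omega> S\<rbrakk> \<Longrightarrow> conv_fun S k f x = ip (N x) f"
    using conv_fun_representers[OF S sym smooth k] by metis
  have swap: "conv_ker2 S l k K x y = conv_fun S k (M x) y" if x: "x \<in> \<Omega> S" and y: "y \<in> \<Omega> S" for x y
  proof -
    have inner: "(LINT z2:\<Omega> S|lborel. K (x - z1) (y - z2) * dens S (tg S l) z1 * dens S (tg S k) z2)
        = N y (x - z1) * dens S (tg S l) z1" for z1
    proof -
      have "(LINT z2:\<Omega> S|lborel. K (x - z1) (y - z2) * dens S (tg S l) z1 * dens S (tg S k) z2)
          = (LINT z2:\<Omega> S|lborel. dens S (tg S l) z1 * (K (x - z1) (y - z2) * dens S (tg S k) z2))"
        by (simp add: mult_ac)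
      also have "\<dots> = dens S (tg S l) z1 * conv_fun S k (K (x - z1)) y"
        by (simp only: set_integral_mult_right conv_fun_def)
      also have "conv_fun S k (K (x - z1)) y = N y (x - z1)"
        by (simp add: N y kernel_mem reproducing)
      finally show ?thesis by simp
    qed
    have "conv_ker2 S l k K x y = conv_fun S l (N y) x"
      unfolding conv_ker2_def inner conv_fun_def ..
    also have "\<dots> = ip (N y) (M x)" using M N x y ip_commute by metis
    also have "\<dots> = conv_fun S k (M x) y" using M N x y by simp
    finally show ?thesis .
  qed
  have "D_op S k m (\<lambda>y. conv_ker2 S l k K x y) = conv_fun S l q x" if x: "x \<in> \<Omega> S" for x
  proof -
    have "D_op S k m (\<lambda>y. conv_ker2 S l k K x y) = D_op S k m (conv_fun S k (M x))"
      by (rule D_op_cong[OF S m swap[OF x]])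
    also have "\<dots> = ip (M x) q" using q M x ip_commute by metis
    also have "\<dots> = conv_fun S l q x" using M q x by simp
    finally show ?thesis .
  qed
  then have "D_op S l n (\<lambda>x. D_op S k m (\<lambda>y. conv_ker2 S l k K x y)) = D_op S l n (conv_fun S l q)"
    by (rule D_op_cong[OF S n])
  with p q show ?thesis by simp
qed

end

section \<open>Regularized least squares in two Hilbert spaces\<close>

text \<open>
  The system says that the residual at \<open>(V, W)\<close> is \<open>- lam1 * lam2 / c * \<alpha>\<close>.  Then the terms linear in
  \<open>(\<phi> - V, \<psi> - W)\<close> cancel in \<open>J\<close>, and \<open>J (\<phi>, \<psi>)\<close> exceeds \<open>J (V, W)\<close> by at least
  \<open>lam1 * \<parallel>\<phi> - V\<parallel>\<^sup>2 + lam2 * \<parallel>\<psi> - W\<parallel>\<^sup>2\<close>.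
\<close>

lemma regularized_least_squares_minimizer:
  fixes n :: nat and p r :: "nat \<Rightarrow> real \<Rightarrow> real" and w \<alpha> f :: "nat \<Rightarrow> real"
  assumes rkhs1: "rkhs K1 H1 ip1" and rkhs2: "rkhs K2 H2 ip2"
    and p: "\<And>i. i < n \<Longrightarrow> p i \<in> H1" and r: "\<And>i. i < n \<Longrightarrow> r i \<in> H2"
    and w: "\<And>i. i < n \<Longrightarrow> 0 < w i" and pos: "0 < c" "0 < lam1" "0 < lam2"
    and J: "\<And>\<phi> \<psi>. \<lbrakk>\<phi> \<in> H1; \<psi> \<in> H2\<rbrakk> \<Longrightarrow> J (\<phi>, \<psi>) =
      c * (\<Sum>i<n. (ip1 (p i) \<phi> + ip2 (r i) \<psi> - f i)\<^sup>2 * w i) + lam1 * ip1 \<phi> \<phi> + lam2 * ip2 \<psi> \<psi>"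
    and system: "\<And>i. i < n \<Longrightarrow>
      (\<Sum>j<n. (lam2 * ip1 (p i) (p j) + lam1 * ip2 (r i) (r j)) * (w j * \<alpha> j)) + lam1 * lam2 / c * \<alpha> i = f i"
    and V: "V = (\<lambda>y. \<Sum>i<n. lam2 * \<alpha> i * w i * p i y)"
    and W: "W = (\<lambda>y. \<Sum>i<n. lam1 * \<alpha> i * w i * r i y)"
  shows "is_arg_min J (\<lambda>q. q \<in> H1 \<times> H2) (\<phi>, \<psi>) \<longleftrightarrow> \<phi> = V \<and> \<psi> = W"
proof -
  interpret h1: rkhs K1 H1 ip1 by (rule rkhs1)
  interpret h2: rkhs K2 H2 ip2 by (rule rkhs2)
  have V_mem: "V \<in> H1" unfolding V using p by (intro h1.sum_mem) auto
  have W_mem: "W \<in> H2" unfolding W using r by (intro h2.sum_mem) auto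
  have ipV: "ip1 V g = (\<Sum>i<n. lam2 * \<alpha> i * w i * ip1 (p i) g)" if "g \<in> H1" for g
    unfolding V using p that by (intro h1.ip_sum_left) auto
  have ipW: "ip2 W g = (\<Sum>i<n. lam1 * \<alpha> i * w i * ip2 (r i) g)" if "g \<in> H2" for g
    unfolding W using r that by (intro h2.ip_sum_left) auto
  have residual: "ip1 (p i) V + ip2 (r i) W - f i = - (lam1 * lam2 / c * \<alpha> i)" if "i < n" for i
  proof -
    have "ip1 (p i) V + ip2 (r i) W = ip1 V (p i) + ip2 W (r i)"
      using h1.ip_commute h2.ip_commute V_mem W_mem p r that by simp
    also have "\<dots> = (\<Sum>j<n. lam2 * \<alpha> j * w j * ip1 (p j) (p i)) + (\<Sum>j<n. lam1 * \<alpha> j * w j * ip2 (r j) (r i))"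
      using ipV ipW p r that by simp
    also have "\<dots> = (\<Sum>j<n. (lam2 * ip1 (p i) (p j) + lam1 * ip2 (r i) (r j)) * (w j * \<alpha> j))"
      unfolding sum.distrib[symmetric]
    proof (rule sum.cong[OF refl])
      fix j
      assume "j \<in> {..<n}"
      then have "ip1 (p j) (p i) = ip1 (p i) (p j)" "ip2 (r j) (r i) = ip2 (r i) (r j)"
        using h1.ip_commute h2.ip_commute p r that by auto
      then show "lam2 * \<alpha> j * w j * ip1 (p j) (p i) + lam1 * \<alpha> j * w j * ip2 (r j) (r i)
          = (lam2 * ip1 (p i) (p j) + lam1 * ip2 (r i) (r j)) * (w j * \<alpha> j)"
        by (simp add: algebra_simps)
    qed
    finally show ?thesis using system[OF that] by simp
  qed
  have gap: "J (V, W) + lam1 * ip1 (\<lambda>x. \<phi> x - V x) (\<lambda>x. \<phi> x - V x)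
      + lam2 * ip2 (\<lambda>x. \<psi> x - W x) (\<lambda>x. \<psi> x - W x) \<le> J (\<phi>, \<psi>)"
    if \<phi>: "\<phi> \<in> H1" and \<psi>: "\<psi> \<in> H2" for \<phi> \<psi>
  proof -
    define e where "e i = (ip1 (p i) \<phi> - ip1 (p i) V) + (ip2 (r i) \<psi> - ip2 (r i) W)" for i
    have square: "(ip1 (p i) \<phi> + ip2 (r i) \<psi> - f i)\<^sup>2 * w i
        = (ip1 (p i) V + ip2 (r i) W - f i)\<^sup>2 * w i
          - 2 * (lam1 * lam2 / c) * (\<alpha> i * w i * e i) + (e i)\<^sup>2 * w i" if "i < n" for i
    proof -
      have *: "ip1 (p i) \<phi> + ip2 (r i) \<psi> - f i = - (lam1 * lam2 / c * \<alpha> i) + e i"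
        using residual[OF that] by (simp add: e_def)
      show ?thesis unfolding * residual[OF that] by (simp add: power2_eq_square algebra_simps)
    qed
    have expand: "(\<Sum>i<n. (ip1 (p i) \<phi> + ip2 (r i) \<psi> - f i)\<^sup>2 * w i)
        = (\<Sum>i<n. (ip1 (p i) V + ip2 (r i) W - f i)\<^sup>2 * w i)
          - 2 * (lam1 * lam2 / c) * (\<Sum>i<n. \<alpha> i * w i * e i) + (\<Sum>i<n. (e i)\<^sup>2 * w i)"
      by (simp add: square sum.distrib sum_subtractf sum_distrib_left)
    have "c * (\<Sum>i<n. (ip1 (p i) \<phi> + ip2 (r i) \<psi> - f i)\<^sup>2 * w i)
        = c * (\<Sum>i<n. (ip1 (p i) V + ip2 (r i) W - f i)\<^sup>2 * w i)
          - 2 * (lam1 * lam2 * (\<Sum>i<n. \<alpha> i * w i * e i)) + c * (\<Sum>i<n. (e i)\<^sup>2 * w i)"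
      unfolding expand using pos by (simp add: distrib_left right_diff_distrib)
    moreover have "0 \<le> c * (\<Sum>i<n. (e i)\<^sup>2 * w i)"
      using pos w by (intro mult_nonneg_nonneg sum_nonneg) (auto simp: less_imp_le)
    moreover have "lam1 * lam2 * (\<Sum>i<n. \<alpha> i * w i * e i)
        = lam1 * (ip1 V \<phi> - ip1 V V) + lam2 * (ip2 W \<psi> - ip2 W W)"
      by (simp add: ipV ipW \<phi> \<psi> V_mem W_mem e_def sum_distrib_left sum_subtractf[symmetric]
          sum.distrib[symmetric] algebra_simps)
    moreover have "lam1 * ip1 (\<lambda>x. \<phi> x - V x) (\<lambda>x. \<phi> x - V x)
        = lam1 * ip1 \<phi> \<phi> - 2 * (lam1 * ip1 V \<phi>) + lam1 * ip1 V V"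
      unfolding h1.ip_diff_self[OF \<phi> V_mem] h1.ip_commute[OF \<phi> V_mem] by (simp add: algebra_simps)
    moreover have "lam2 * ip2 (\<lambda>x. \<psi> x - W x) (\<lambda>x. \<psi> x - W x)
        = lam2 * ip2 \<psi> \<psi> - 2 * (lam2 * ip2 W \<psi>) + lam2 * ip2 W W"
      unfolding h2.ip_diff_self[OF \<psi> W_mem] h2.ip_commute[OF \<psi> W_mem] by (simp add: algebra_simps)
    ultimately show ?thesis
      unfolding J[OF \<phi> \<psi>] J[OF V_mem W_mem] by (simp add: algebra_simps)
  qed
  have nonneg: "0 \<le> lam1 * ip1 (\<lambda>x. \<phi> x - V x) (\<lambda>x. \<phi> x - V x)"
    "0 \<le> lam2 * ip2 (\<lambda>x. \<psi> x - W x) (\<lambda>x. \<psi> x - W x)"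
    if "\<phi> \<in> H1" "\<psi> \<in> H2" for \<phi> \<psi>
    using pos h1.ip_nonneg[OF h1.diff_mem[OF that(1) V_mem]] h2.ip_nonneg[OF h2.diff_mem[OF that(2) W_mem]]
    by simp_all
  have minimal: "J (V, W) \<le> J q" if "q \<in> H1 \<times> H2" for q
  proof -
    obtain \<phi> \<psi> where q: "q = (\<phi>, \<psi>)" "\<phi> \<in> H1" "\<psi> \<in> H2" using \<open>q \<in> H1 \<times> H2\<close> by auto
    show ?thesis using gap[OF q(2,3)] nonneg[OF q(2,3)] unfolding q(1) by linarith
  qed
  show ?thesis
  proof
    assume "is_arg_min J (\<lambda>q. q \<in> H1 \<times> H2) (\<phi>, \<psi>)"
    then have \<phi>: "\<phi> \<in> H1" and \<psi>: "\<psi> \<in> H2" and "J (\<phi>, \<psi>) \<le> J (V, W)"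
      using V_mem W_mem by (auto simp: is_arg_min_def not_less)
    with gap[OF \<phi> \<psi>] nonneg[OF \<phi> \<psi>]
    have "lam1 * ip1 (\<lambda>x. \<phi> x - V x) (\<lambda>x. \<phi> x - V x) = 0"
      "lam2 * ip2 (\<lambda>x. \<psi> x - W x) (\<lambda>x. \<psi> x - W x) = 0" by linarith+
    then have "(\<lambda>x. \<phi> x - V x) = (\<lambda>x. 0)" "(\<lambda>x. \<psi> x - W x) = (\<lambda>x. 0)"
      using pos h1.ip_definite[OF h1.diff_mem[OF \<phi> V_mem]] h2.ip_definite[OF h2.diff_mem[OF \<psi> W_mem]]
      by auto
    then show "\<phi> = V \<and> \<psi> = W" by (auto simp: fun_eq_iff)
  next
    assume "\<phi> = V \<and> \<psi> = W"
    then show "is_arg_min J (\<lambda>q. q \<in> H1 \<times> H2) (\<phi>, \<psi>)"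
      using V_mem W_mem minimal by (auto simp: is_arg_min_def not_less)
  qed
qed

section \<open>The linear system on the grid\<close>

(* The symbol $ is used only for the entries of Matrix.vec. *)
unbundle no vec_syntax

lemma sum_grid:
  fixes g :: "nat \<Rightarrow> nat \<Rightarrow> real"
  assumes "0 < nx S"
  shows "(\<Sum>l=1..nt S. \<Sum>n=1..nx S. g l n) = (\<Sum>i<grid_dim S. g (ti S i) (xi S i))"
proof -
  have "(\<Sum>l=1..nt S. \<Sum>n=1..nx S. g l n) = (\<Sum>(l, n)\<in>{1..nt S} \<times> {1..nx S}. g l n)"
    by (simp add: sum.cartesian_product)
  also have "\<dots> = (\<Sum>i<grid_dim S. g (ti S i) (xi S i))"
  proof (rule sum.reindex_bij_witness[of _ "\<lambda>i. (ti S i, xi S i)" "\<lambda>(l, n). (l - 1) * nx S + (n - 1)"])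
    fix p
    assume "p \<in> {1..nt S} \<times> {1..nx S}"
    then obtain l n where p: "p = (Suc l, Suc n)" "l < nt S" "n < nx S"
    proof -
      obtain l n where "p = (l, n)" "l \<in> {1..nt S}" "n \<in> {1..nx S}"
        using \<open>p \<in> {1..nt S} \<times> {1..nx S}\<close> by blast
      then show ?thesis using that[of "l - 1" "n - 1"] by auto
    qed
    have "l * nx S + n < Suc l * nx S" using p by simp
    also have "\<dots> \<le> nt S * nx S" using p by (intro mult_right_mono) auto
    finally show "(case p of (l, n) \<Rightarrow> (l - 1) * nx S + (n - 1)) \<in> {..<grid_dim S}"
      using p by (simp add: grid_dim_def mult.commute)
    show "(ti S (case p of (l, n) \<Rightarrow> (l - 1) * nx S + (n - 1)),
        xi S (case p of (l, n) \<Rightarrow> (l - 1) * nx S + (n - 1))) = p"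
      using p by (simp add: ti_def xi_def)
    show "g (ti S (case p of (l, n) \<Rightarrow> (l - 1) * nx S + (n - 1)))
        (xi S (case p of (l, n) \<Rightarrow> (l - 1) * nx S + (n - 1))) = (case p of (l, n) \<Rightarrow> g l n)"
      using p by (simp add: ti_def xi_def)
  next
    fix i
    assume "i \<in> {..<grid_dim S}"
    then have "i div nx S < nt S" using assms by (simp add: grid_dim_def less_mult_imp_div_less mult.commute)
    moreover have "i mod nx S < nx S" using assms by simp
    ultimately show "(ti S i, xi S i) \<in> {1..nt S} \<times> {1..nx S}" by (simp add: ti_def xi_def)
    show "(case (ti S i, xi S i) of (l, n) \<Rightarrow> (l - 1) * nx S + (n - 1)) = i"
      by (simp add: ti_def xi_def)
  qed
  finally show ?thesis .
qed

lemma ti_xi_mem: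
  assumes "valid_observation S" "i < grid_dim S"
  shows "ti S i \<in> {1..nt S}" "xi S i \<in> {1..nx S}"
proof -
  have nx: "0 < nx S" using assms(1) by (simp add: valid_observation_def)
  have "i div nx S < nt S" using assms(2) by (simp add: grid_dim_def less_mult_imp_div_less mult.commute)
  moreover have "i mod nx S < nx S" using nx by simp
  ultimately show "ti S i \<in> {1..nt S}" "xi S i \<in> {1..nx S}" by (simp_all add: ti_def xi_def)
qed

text \<open>The density at the grid point in position \<open>i\<close>: the \<open>i\<close>-th diagonal entry of \<open>C_rho\<close>.\<close>

definition weight :: "observation \<Rightarrow> nat \<Rightarrow> real" where
  "weight S i = dens S (tg S (ti S i)) (xg S (xi S i))"

lemma weight_pos: "\<lbrakk>valid_observation S; i < grid_dim S\<rbrakk> \<Longrightarrow> 0 < weight S i"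
  using ti_xi_mem[of S i] by (auto simp: weight_def valid_observation_def)

lemma mult_mat_vec_index:
  assumes "A \<in> carrier_mat m n" "v \<in> carrier_vec n" "i < m"
  shows "(A *\<^sub>v v) $ i = (\<Sum>j<n. A $$ (i, j) * v $ j)"
  using assms by (simp add: scalar_prod_def atLeast0LessThan)

lemma C_rho_carrier: "C_rho S \<in> carrier_mat (grid_dim S) (grid_dim S)"
  by (simp add: C_rho_def)

lemma C_rho_mult_vec:
  assumes "v \<in> carrier_vec (grid_dim S)"
  shows "C_rho S *\<^sub>v v = Matrix.vec (grid_dim S) (\<lambda>i. weight S i * v $ i)"
proof (rule eq_vecI)
  fix i
  assume "i < dim_vec (Matrix.vec (grid_dim S) (\<lambda>i. weight S i * v $ i))"
  then have i: "i < grid_dim S" by simp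
  have "(C_rho S *\<^sub>v v) $ i = (\<Sum>j\<in>{0..<grid_dim S}. (if i = j then weight S j else 0) * v $ j)"
    unfolding weight_def using i assms by (simp add: C_rho_def mat_diag_def scalar_prod_def)
  also have "\<dots> = (\<Sum>j\<in>{0..<grid_dim S}. if i = j then weight S i * v $ j else 0)"
    by (rule sum.cong) auto
  also have "\<dots> = weight S i * v $ i" using i by simp
  finally show "(C_rho S *\<^sub>v v) $ i = Matrix.vec (grid_dim S) (\<lambda>i. weight S i * v $ i) $ i"
    using i by simp
qed (simp add: C_rho_def mat_diag_def)

lemma inner_C_eq:
  assumes "u \<in> carrier_vec (grid_dim S)" "v \<in> carrier_vec (grid_dim S)"
  shows "inner_C S u v = (\<Sum>i<grid_dim S. u $ i * weight S i * v $ i)"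
  using assms by (simp add: inner_C_def C_rho_mult_vec scalar_prod_def atLeast0LessThan mult.assoc)

lemma system_mat_carrier: "system_mat S K1 K2 lam1 lam2 \<in> carrier_mat (grid_dim S) (grid_dim S)"
  by (auto simp: system_mat_def gram_def C_rho_def Delta11_def Delta11_conv_def)

lemma system_mat_mult_vec:
  assumes v: "v \<in> carrier_vec (grid_dim S)" and i: "i < grid_dim S"
  shows "(system_mat S K1 K2 lam1 lam2 *\<^sub>v v) $ i = weight S i *
    ((\<Sum>j<grid_dim S. (lam2 * Delta11 S K1 $$ (i, j) + lam1 * Delta11_conv S K2 $$ (i, j))
        * (weight S j * v $ j))
      + lam1 * lam2 * (real (nx S) * real (nt S)) / (horizon S * vol S) * v $ i)"
proof -
  let ?N = "grid_dim S" and ?C = "C_rho S"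
  let ?Q = "lam2 \<cdot>\<^sub>m Delta11 S K1 + lam1 \<cdot>\<^sub>m Delta11_conv S K2"
  let ?\<mu> = "lam1 * lam2 * (real (nx S) * real (nt S)) / (horizon S * vol S)"
  have D: "Delta11 S K1 \<in> carrier_mat ?N ?N" "Delta11_conv S K2 \<in> carrier_mat ?N ?N"
    by (simp_all add: Delta11_def Delta11_conv_def)
  have Q: "?Q \<in> carrier_mat ?N ?N" using D by simp
  have C: "?C \<in> carrier_mat ?N ?N" by (rule C_rho_carrier)
  let ?u = "?C *\<^sub>v v"
  have u: "?u \<in> carrier_vec ?N" using C v by simp
  have "system_mat S K1 K2 lam1 lam2 *\<^sub>v v = (?C * ?Q * ?C) *\<^sub>v v + (?\<mu> \<cdot>\<^sub>m ?C) *\<^sub>v v"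
    unfolding system_mat_def gram_def using C Q v by (intro add_mult_distrib_mat_vec) auto
  also have "(?C * ?Q * ?C) *\<^sub>v v = ?C *\<^sub>v (?Q *\<^sub>v ?u)"
    using C Q v u by (simp add: assoc_mult_mat_vec[of _ ?N ?N _ ?N])
  also have "(?\<mu> \<cdot>\<^sub>m ?C) *\<^sub>v v = ?\<mu> \<cdot>\<^sub>v ?u"
    using C v by (intro eq_vecI) (auto simp: scalar_prod_def sum_distrib_left mult.assoc)
  finally have "(system_mat S K1 K2 lam1 lam2 *\<^sub>v v) $ i = weight S i * (?Q *\<^sub>v ?u) $ i + ?\<mu> * ?u $ i"
    using i C Q u by (simp add: C_rho_mult_vec[of "?Q *\<^sub>v ?u"])
  moreover have "(?Q *\<^sub>v ?u) $ i = (\<Sum>j<?N. ?Q $$ (i, j) * ?u $ j)"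
    by (rule mult_mat_vec_index[OF Q u i])
  moreover have "\<dots> = (\<Sum>j<?N. (lam2 * Delta11 S K1 $$ (i, j) + lam1 * Delta11_conv S K2 $$ (i, j))
        * (weight S j * v $ j))"
    using i D v by (intro sum.cong) (auto simp: C_rho_mult_vec)
  moreover have "?u $ i = weight S i * v $ i" using i v by (simp add: C_rho_mult_vec)
  ultimately show ?thesis by (simp add: algebra_simps)
qed

lemma invertible_of_trivial_kernel:
  fixes A :: "'a::field Matrix.mat"
  assumes A: "A \<in> carrier_mat n n"
    and inj: "\<And>v. \<lbrakk>v \<in> carrier_vec n; A *\<^sub>v v = 0\<^sub>v n\<rbrakk> \<Longrightarrow> v = 0\<^sub>v n"
  obtains B where "mat_inverse A = Some B" "A * B = 1\<^sub>m n" "B * A = 1\<^sub>m n" "B \<in> carrier_mat n n"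
proof -
  have "det A \<noteq> 0" using det_0_iff_vec_prod_zero_field[OF A] inj by blast
  then have "A \<in> Units (ring_mat TYPE('a) n ())" by (rule det_non_zero_imp_unit[OF A])
  then obtain B where B: "mat_inverse A = Some B"
    using mat_inverse(1)[OF A, of "()"] by (cases "mat_inverse A") auto
  with mat_inverse(2)[OF A B] that show ?thesis by blast
qed

section \<open>The representation of the minimizer\<close>

theorem proposition3p8:
  fixes S :: observation
    and fl :: flow
    and U :: "real \<Rightarrow> real"
    and K1 K2 :: "real \<Rightarrow> real \<Rightarrow> real"
    and H1 H2 :: "(real \<Rightarrow> real) set"
    and ip1 ip2 :: "(real \<Rightarrow> real) \<Rightarrow> (real \<Rightarrow> real) \<Rightarrow> real"
    and lam1 lam2 :: real
  assumes obs: "valid_observation S"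
    and mercer: "mercer_kernel K1" "mercer_kernel K2"
    and smooth: "Ck_square 4 (\<Omega> S) K1" "Ck_square 4 (\<Omega> S) K2"
    and smooth_conv: "Ck_square 4 {x - z | x z. x \<in> \<Omega> S \<and> z \<in> \<Omega> S} K2"
    and rkhs1: "rkhs K1 H1 ip1"
    and rkhs2: "rkhs K2 H2 ip2"
    and lam: "lam1 > 0" "lam2 > 0"
  shows "invertible_mat (system_mat S K1 K2 lam1 lam2) \<and>
    (\<forall>V W. is_minimizer S fl U lam1 lam2 H1 ip1 H2 ip2 (V, W) \<longleftrightarrow>
       V = (\<lambda>y. inner_C S (C1_hat S fl U K1 K2 lam1 lam2) (Delta10 S K1 y)) \<and>
       W = (\<lambda>y. inner_C S (C2_hat S fl U K1 K2 lam1 lam2) (Delta10_conv S K2 y)))"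
proof -
  interpret h1: rkhs K1 H1 ip1 by (rule rkhs1)
  interpret h2: rkhs K2 H2 ip2 by (rule rkhs2)
  have sym1: "K1 x y = K1 y x" and sym2: "K2 x y = K2 y x" for x y
    using mercer by (simp_all add: mercer_kernel_def)
  let ?N = "grid_dim S" and ?M = "system_mat S K1 K2 lam1 lam2" and ?w = "weight S"
  define c where "c = horizon S * vol S / (real (nx S) * real (nt S))"
  have c: "0 < c" using obs by (simp add: c_def valid_observation_def vol_def)
  have nx: "0 < nx S" using obs by (simp add: valid_observation_def)
  have \<mu>: "lam1 * lam2 * (real (nx S) * real (nt S)) / (horizon S * vol S) = lam1 * lam2 / c"
    by (simp add: c_def)
  note ti = ti_xi_mem(1)[OF obs] and xi = ti_xi_mem(2)[OF obs]
  have "\<exists>p. p \<in> H1 \<and> (\<forall>f\<in>H1. D_at S i f = ip1 p f)" if "i < ?N" for i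
    unfolding D_at_def using h1.D_op_representer[OF obs sym1 smooth(1) xi[OF that]] by metis
  then obtain p where p: "\<And>i. i < ?N \<Longrightarrow> p i \<in> H1"
    and Dp: "\<And>i f. \<lbrakk>i < ?N; f \<in> H1\<rbrakk> \<Longrightarrow> D_at S i f = ip1 (p i) f" by metis
  have "\<exists>r. r \<in> H2 \<and> (\<forall>f\<in>H2. D_at S i (conv_fun S (ti S i) f) = ip2 r f)" if "i < ?N" for i
    unfolding D_at_def
    using h2.D_op_conv_representer[OF obs sym2 smooth_conv ti[OF that] xi[OF that]] by metis
  then obtain r where r: "\<And>i. i < ?N \<Longrightarrow> r i \<in> H2"
    and Dr: "\<And>i f. \<lbrakk>i < ?N; f \<in> H2\<rbrakk> \<Longrightarrow> D_at S i (conv_fun S (ti S i) f) = ip2 (r i) f" by metis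
  have gram1: "Delta11 S K1 $$ (i, j) = ip1 (p i) (p j)" if "i < ?N" "j < ?N" for i j
    using h1.D_op_D_op_kernel[OF p[OF that(1)] Dp[OF that(1), unfolded D_at_def]
        p[OF that(2)] Dp[OF that(2), unfolded D_at_def]] that
    by (simp add: Delta11_def D_at_def)
  have gram2: "Delta11_conv S K2 $$ (i, j) = ip2 (r i) (r j)" if "i < ?N" "j < ?N" for i j
    using h2.D_op_D_op_conv_kernel[OF obs sym2 smooth_conv ti[OF that(1)] ti[OF that(2)]
        xi[OF that(1)] xi[OF that(2)] r[OF that(1)] Dr[OF that(1), unfolded D_at_def]
        r[OF that(2)] Dr[OF that(2), unfolded D_at_def]] that
    by (simp add: Delta11_conv_def D_at_def)
  have M_vec: "(?M *\<^sub>v v) $ i = ?w i *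
      ((\<Sum>j<?N. (lam2 * ip1 (p i) (p j) + lam1 * ip2 (r i) (r j)) * (?w j * v $ j)) + lam1 * lam2 / c * v $ i)"
    if "v \<in> carrier_vec ?N" "i < ?N" for v i
    unfolding system_mat_mult_vec[OF that] \<mu> using that by (simp add: gram1 gram2)
  \<comment> \<open>With \<open>b = C_rho v\<close>, the equation \<open>v \<bullet> (M v) = 0\<close> is a sum of three nonnegative terms, the last one definite.\<close>
  have kernel: "v = 0\<^sub>v ?N" if v: "v \<in> carrier_vec ?N" and Mv: "?M *\<^sub>v v = 0\<^sub>v ?N" for v
  proof -
    define b where "b i = ?w i * v $ i" for i
    let ?P = "\<lambda>y. \<Sum>i<?N. b i * p i y" and ?R = "\<lambda>y. \<Sum>i<?N. b i * r i y"
    have P: "?P \<in> H1" and R: "?R \<in> H2"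
      using p r by (auto intro!: h1.sum_mem h2.sum_mem)
    have row: "(\<Sum>j<?N. (lam2 * ip1 (p i) (p j) + lam1 * ip2 (r i) (r j)) * b j) + lam1 * lam2 / c * v $ i = 0"
      if "i < ?N" for i
      using M_vec[OF v that] weight_pos[OF obs that] Mv that by (simp add: b_def)
    have PP: "ip1 ?P ?P = (\<Sum>i<?N. \<Sum>j<?N. b i * (b j * ip1 (p i) (p j)))"
    proof -
      have "ip1 (p i) ?P = (\<Sum>j<?N. b j * ip1 (p i) (p j))" if "i < ?N" for i
        using h1.ip_sum_left[of "{..<?N}" p "p i" b] h1.ip_commute p that P by simp
      then show ?thesis
        using h1.ip_sum_left[of "{..<?N}" p ?P b] p P by (simp add: sum_distrib_left)
    qed
    have RR: "ip2 ?R ?R = (\<Sum>i<?N. \<Sum>j<?N. b i * (b j * ip2 (r i) (r j)))"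
    proof -
      have "ip2 (r i) ?R = (\<Sum>j<?N. b j * ip2 (r i) (r j))" if "i < ?N" for i
        using h2.ip_sum_left[of "{..<?N}" r "r i" b] h2.ip_commute r that R by simp
      then show ?thesis
        using h2.ip_sum_left[of "{..<?N}" r ?R b] r R by (simp add: sum_distrib_left)
    qed
    have "0 = (\<Sum>i<?N. b i * ((\<Sum>j<?N. (lam2 * ip1 (p i) (p j) + lam1 * ip2 (r i) (r j)) * b j)
        + lam1 * lam2 / c * v $ i))"
      by (intro sum.neutral[symmetric] ballI) (simp only: row lessThan_iff mult_zero_right)
    also have "\<dots> = lam2 * ip1 ?P ?P + lam1 * ip2 ?R ?R + lam1 * lam2 / c * (\<Sum>i<?N. b i * v $ i)"
      unfolding PP RR by (simp add: sum.distrib sum_distrib_left algebra_simps)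
    also have "(\<Sum>i<?N. b i * v $ i) = (\<Sum>i<?N. ?w i * (v $ i)\<^sup>2)"
      by (simp add: b_def power2_eq_square mult.assoc)
    finally have "lam1 * lam2 / c * (\<Sum>i<?N. ?w i * (v $ i)\<^sup>2) \<le> 0"
      using mult_nonneg_nonneg[OF less_imp_le[OF lam(2)] h1.ip_nonneg[OF P]]
        mult_nonneg_nonneg[OF less_imp_le[OF lam(1)] h2.ip_nonneg[OF R]] by linarith
    moreover have nonneg: "0 \<le> ?w i * (v $ i)\<^sup>2" if "i < ?N" for i
      using weight_pos[OF obs that] by simp
    ultimately have "(\<Sum>i<?N. ?w i * (v $ i)\<^sup>2) = 0"
      using lam c sum_nonneg[of "{..<?N}" "\<lambda>i. ?w i * (v $ i)\<^sup>2"]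
      by (auto simp: mult_le_0_iff divide_le_0_iff intro: antisym)
    then have "?w i * (v $ i)\<^sup>2 = 0" if "i < ?N" for i
      using sum_nonneg_eq_0_iff[of "{..<?N}" "\<lambda>i. ?w i * (v $ i)\<^sup>2"] nonneg that by simp
    then have "v $ i = 0" if "i < ?N" for i
      using weight_pos[OF obs that] that by fastforce
    then show ?thesis using v by (intro eq_vecI) auto
  qed
  obtain B where B: "mat_inverse ?M = Some B" "?M * B = 1\<^sub>m ?N" "B * ?M = 1\<^sub>m ?N" "B \<in> carrier_mat ?N ?N"
    using invertible_of_trivial_kernel[OF system_mat_carrier kernel] by metis
  have "invertible_mat ?M"
    using B system_mat_carrier[of S K1 K2 lam1 lam2]
    unfolding invertible_mat_def inverts_mat_def square_mat.simps by (intro conjI exI[of _ B]) auto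
  moreover have "is_minimizer S fl U lam1 lam2 H1 ip1 H2 ip2 (V, W) \<longleftrightarrow>
       V = (\<lambda>y. inner_C S (C1_hat S fl U K1 K2 lam1 lam2) (Delta10 S K1 y)) \<and>
       W = (\<lambda>y. inner_C S (C2_hat S fl U K1 K2 lam1 lam2) (Delta10_conv S K2 y))" for V W
  proof -
    let ?f = "data_vec S fl U"
    define \<alpha> where "\<alpha> = B *\<^sub>v (C_rho S *\<^sub>v ?f)"
    have f: "?f \<in> carrier_vec ?N" by (simp add: data_vec_def)
    have Cf: "C_rho S *\<^sub>v ?f \<in> carrier_vec ?N" by (rule mult_mat_vec_carrier[OF C_rho_carrier f])
    have \<alpha>: "\<alpha> \<in> carrier_vec ?N" using B Cf by (simp add: \<alpha>_def)
    have coeffs: "C1_hat S fl U K1 K2 lam1 lam2 = lam2 \<cdot>\<^sub>v \<alpha>" "C2_hat S fl U K1 K2 lam1 lam2 = lam1 \<cdot>\<^sub>v \<alpha>"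
      by (simp_all add: C1_hat_def C2_hat_def inv_mat_def B(1) \<alpha>_def)
    have "?M *\<^sub>v \<alpha> = C_rho S *\<^sub>v ?f"
      unfolding \<alpha>_def using B Cf system_mat_carrier
      by (simp flip: assoc_mult_mat_vec[of ?M ?N ?N B ?N])
    then have system: "(\<Sum>j<?N. (lam2 * ip1 (p i) (p j) + lam1 * ip2 (r i) (r j)) * (?w j * \<alpha> $ j))
        + lam1 * lam2 / c * \<alpha> $ i = ?f $ i" if "i < ?N" for i
      using M_vec[OF \<alpha> that] weight_pos[OF obs that] that f by (simp add: C_rho_mult_vec)
    \<comment> \<open>A representer is recovered from its functional by \<open>p i y = \<langle>p i, K1 y\<rangle>\<close>.\<close>
    have V: "(\<lambda>y. inner_C S (C1_hat S fl U K1 K2 lam1 lam2) (Delta10 S K1 y))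
        = (\<lambda>y. \<Sum>i<?N. lam2 * \<alpha> $ i * ?w i * p i y)"
    proof
      fix y
      have "D_at S i (\<lambda>x. K1 x y) = p i y" if "i < ?N" for i
        unfolding sym1[of _ y] using Dp[OF that h1.kernel_mem] h1.reproducing[OF p[OF that]] by simp
      then show "inner_C S (C1_hat S fl U K1 K2 lam1 lam2) (Delta10 S K1 y)
          = (\<Sum>i<?N. lam2 * \<alpha> $ i * ?w i * p i y)"
        using \<alpha> by (simp add: inner_C_eq coeffs Delta10_def)
    qed
    have W: "(\<lambda>y. inner_C S (C2_hat S fl U K1 K2 lam1 lam2) (Delta10_conv S K2 y))
        = (\<lambda>y. \<Sum>i<?N. lam1 * \<alpha> $ i * ?w i * r i y)"
    proof
      fix y
      have "D_at S i (\<lambda>x. conv_ker S (ti S i) K2 x y) = r i y" if "i < ?N" for i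
      proof -
        have "(\<lambda>x. conv_ker S (ti S i) K2 x y) = conv_fun S (ti S i) (K2 y)"
          unfolding conv_ker_def conv_fun_def by (subst sym2) (rule refl)
        then show ?thesis
          using Dr[OF that h2.kernel_mem] h2.reproducing[OF r[OF that]] by simp
      qed
      then show "inner_C S (C2_hat S fl U K1 K2 lam1 lam2) (Delta10_conv S K2 y)
          = (\<Sum>i<?N. lam1 * \<alpha> $ i * ?w i * r i y)"
        using \<alpha> by (simp add: inner_C_eq coeffs Delta10_conv_def)
    qed
    have loss: "(case (\<phi>, \<psi>) of (\<phi>, \<psi>) \<Rightarrow> reg_loss S fl U lam1 lam2 ip1 ip2 \<phi> \<psi>)
        = c * (\<Sum>i<?N. (ip1 (p i) \<phi> + ip2 (r i) \<psi> - ?f $ i)\<^sup>2 * ?w i)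
          + lam1 * ip1 \<phi> \<phi> + lam2 * ip2 \<psi> \<psi>"
      if \<phi>: "\<phi> \<in> H1" and \<psi>: "\<psi> \<in> H2" for \<phi> \<psi>
    proof -
      have A: "A_op S \<phi> \<psi> (ti S i) (xi S i) = ip1 (p i) \<phi> + ip2 (r i) \<psi>" if i: "i < ?N" for i
      proof -
        obtain g1 g2 where 1: "has_two_derivatives (\<Omega> S) \<phi> g1 g2"
          by (rule h1.mem_has_two_derivatives[OF obs sym1 smooth(1) \<phi>])
        obtain h1 h2 where 2: "has_two_derivatives (\<Omega> S) (conv_fun S (ti S i) \<psi>) h1 h2"
          using h2.conv_fun_representers[OF obs sym2 smooth_conv ti[OF i]] \<psi> by metis
        show ?thesis
          unfolding A_op_def D_op_add[OF obs xi[OF i] 1 2]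
          using Dp[OF i \<phi>] Dr[OF i \<psi>] by (simp add: D_at_def)
      qed
      show ?thesis
        unfolding reg_loss_def sum_grid[OF nx] c_def[symmetric] using h1.ip_nonneg[OF \<phi>] h2.ip_nonneg[OF \<psi>]
        by (simp add: A data_vec_def ip_norm_def weight_def)
    qed
    show ?thesis
      unfolding is_minimizer_def V W
      by (rule regularized_least_squares_minimizer[OF rkhs1 rkhs2, where n = ?N and p = p and r = r
            and w = ?w and \<alpha> = "\<lambda>i. \<alpha> $ i" and f = "\<lambda>i. ?f $ i" and c = c and ?lam1.0 = lam1 and ?lam2.0 = lam2])
        (use p r weight_pos[OF obs] c lam loss system in auto)
  qed
  ultimately show ?thesis by blast
qed

end
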